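(* Let $M$ be a simply connected Riemann surface with a complex coordinate $z=x+iy$ defined on $M$, and let $g,h:M\to S^2$ be holomorphic maps such that $g-h\neq 0$ and $g+h\neq 0$ at every point of $M$. Then $$f = 4\,\mathrm{Re}\int \frac{1}{|g-h|^2}\{(g\times h)-i(g-h)\}\,dz$$ gives a non-conformal harmonic surface $f:M\to\mathbb{R}^3$ such that $f^{+}=g$ and $f^{-}=h$, where $f^{\pm}$ are the $(\pm)$transforms of $f$ taken with respect to the adapted coordinate $z$. Conversely, any non-conformal harmonic surface in $\mathbb{R}^3$ can be locally represented in this way: if $f:M\to\mathbb{R}^3$ is a non-conformal harmonic surface, then every point of $M$ has a simply connected neighbourhood $U$ with a complex coordinate $z$ and holomorphic maps $g,h:U\to S^2$ with $g-h\neq 0$ and $g+h\neq0$ everywhere on $U$, such that on $U$ the map $f$ is given by the formula above.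
   Context: $S^2\subset\mathbb{R}^3$ is the unit sphere, $\times$ is the cross product of $\mathbb{R}^3$ and $|\cdot|$ the Euclidean norm; $\langle\,,\rangle$ is the complex bilinear extension of the Euclidean inner product to $\mathbb{C}^3$. $S^2$ carries the complex structure given by stereographic projection $\Pi:S^2\setminus\{(0,0,1)\}\to\mathbb{R}^2=\mathbb{C}$, $\Pi(a,b,c)=(a+ib)/(1-c)$, with inverse $\Pi^{-1}(P)=\frac{1}{|P|^2+1}(2\,\mathrm{Re}P,\,2\,\mathrm{Im}P,\,|P|^2-1)$; thus a map $\Pi^{-1}\circ P$ is holomorphic iff the function $P$ is holomorphic. Indefinite integrals are determined up to an additive constant vector. A non-conformal harmonic surface in $\mathbb{R}^3$ is a harmonic immersion $f:M\to\mathbb{R}^3$ of a Riemann surface $M$ (i.e. $f_{z\bar z}=0$ in local complex coordinates) which is non-conformal at every point, i.e. $\langle f_z,f_z\rangle\ne 0$ everywhere. Around each point there is then a complex coordinate $z=x+iy$ with $\langle f_z,f_z\rangle=-1$, equivalently $|f_y|^2-|f_x|^2=4$ and $\langle f_x,f_y\rangle=0$; such a coordinate is called adapted. With respect to an adapted coordinate, let $N=\frac{f_x\times f_y}{|f_x\times f_y|}$ be the unit normal, and let $\theta$ be the smooth function with $\cos\theta=|f_x|/|f_y|$ and $\sin\theta=2/|f_y|>0$. The $(\pm)$transforms of $f$ are the maps $f^{\pm}$ into $S^2$ defined by $$f^{\varepsilon}=\varepsilon(\sin\theta)\frac{f_y}{|f_y|}+(\cos\theta)N,\qquad \varepsilon=+\text{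 or }-.$$ *)

theory Defs
  imports "HOL-Analysis.Analysis"
begin

unbundle no cross3_syntax

section \<open>Riemann surfaces\<close>

text \<open>
  A Riemann surface is a connected set \<open>M\<close> in a Hausdorff space, with the subspace topology and a
  holomorphic atlas.  The atlas is not required to be maximal; an arbitrary complex coordinate
  is a chart compatible with it.  Functions on \<open>M\<close> are total functions whose
  values outside \<open>M\<close> are irrelevant.
\<close>

type_synonym 'a atlas = "('a set \<times> ('a \<Rightarrow> complex)) set"

definition chart_on :: "'a::t2_space set \<Rightarrow> 'a set \<Rightarrow> ('a \<Rightarrow> complex) \<Rightarrow> bool" where
  "chart_on M U \<phi> \<longleftrightarrow>
     openin (top_of_set M) U \<and> open (\<phi> ` U) \<and> (\<exists>\<psi>. homeomorphism U (\<phi> ` U) \<phi> \<psi>)"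

definition compatible :: "'a set \<times> ('a \<Rightarrow> complex) \<Rightarrow> 'a set \<times> ('a \<Rightarrow> complex) \<Rightarrow> bool" where
  "compatible c d \<longleftrightarrow>
     (case c of (U, \<phi>) \<Rightarrow> case d of (V, \<psi>) \<Rightarrow>
        (\<psi> \<circ> inv_into U \<phi>) holomorphic_on \<phi> ` (U \<inter> V) \<and>
        (\<phi> \<circ> inv_into V \<psi>) holomorphic_on \<psi> ` (U \<inter> V))"

definition riemann_surface :: "'a::t2_space set \<Rightarrow> 'a atlas \<Rightarrow> bool" where
  "riemann_surface M A \<longleftrightarrow>
     M \<noteq> {} \<and> connected M \<and>
     (\<forall>(U, \<phi>)\<in>A. chart_on M U \<phi>) \<and> (\<Union>(U, \<phi>)\<in>A. U) = M \<and>
     (\<forall>c\<in>A. \<forall>d\<in>A. compatible c d)"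

definition complex_coordinate :: "'a::t2_space set \<Rightarrow> 'a atlas \<Rightarrow> 'a set \<Rightarrow> ('a \<Rightarrow> complex) \<Rightarrow> bool"
  where "complex_coordinate M A U z \<longleftrightarrow> chart_on M U z \<and> (\<forall>c\<in>A. compatible (U, z) c)"

definition restrict_atlas :: "'a atlas \<Rightarrow> 'a set \<Rightarrow> 'a atlas" where
  "restrict_atlas A U = (\<lambda>(V, \<phi>). (V \<inter> U, \<phi>)) ` A"

definition holomorphic_map ::
    "'a::t2_space set \<Rightarrow> 'a atlas \<Rightarrow> 'b::t2_space set \<Rightarrow> 'b atlas \<Rightarrow> ('a \<Rightarrow> 'b) \<Rightarrow> bool" where
  "holomorphic_map M A N B g \<longleftrightarrow>
     continuous_on M g \<and> g ` M \<subseteq> N \<and>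
     (\<forall>(U, \<phi>)\<in>A. \<forall>(V, \<psi>)\<in>B. (\<psi> \<circ> g \<circ> inv_into U \<phi>) holomorphic_on \<phi> ` (U \<inter> g -` V))"

section \<open>The Riemann sphere in Euclidean space\<close>

abbreviation S2 :: "(real^3) set" where
  "S2 \<equiv> sphere 0 1"

definition stereo :: "real^3 \<Rightarrow> complex" where
  "stereo p = Complex (p$1) (p$2) / of_real (1 - p$3)"

text \<open>On the sphere, \<open>stereo_inf\<close> is the reciprocal of \<open>stereo\<close>, extended over the north pole.\<close>

definition stereo_inf :: "real^3 \<Rightarrow> complex" where
  "stereo_inf p = Complex (p$1) (- p$2) / of_real (1 + p$3)"

definition S2_atlas :: "(real^3) atlas" where
  "S2_atlas = {(S2 - {vector [0, 0, 1]}, stereo), (S2 - {vector [0, 0, -1]}, stereo_inf)}"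

lemma stereo_inf_eq_inverse_stereo:
  assumes "p \<in> S2" "p$3 \<noteq> 1" "p$3 \<noteq> -1"
  shows "stereo_inf p = inverse (stereo p)"
proof -
  let ?a = "Complex (p$1) (p$2)" and ?b = "Complex (p$1) (- p$2)"
  have "norm p ^ 2 = 1" using assms(1) by simp
  then have "(p$1)^2 + (p$2)^2 + (p$3)^2 = 1"
    unfolding power2_norm_eq_inner by (simp add: inner_vec_def sum_3 power2_eq_square)
  then have s: "(p$1)^2 + (p$2)^2 = (1 - p$3) * (1 + p$3)"
    by (simp add: power2_eq_square algebra_simps)
  have "?a * ?b = of_real ((p$1)^2 + (p$2)^2)"
    by (simp add: complex_eq_iff power2_eq_square)
  then have ab: "?a * ?b = of_real (1 - p$3) * of_real (1 + p$3)"
    unfolding s of_real_mult .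
  have nz: "(of_real (1 - p$3) :: complex) \<noteq> 0" "(of_real (1 + p$3) :: complex) \<noteq> 0"
    using assms(2,3) unfolding of_real_eq_0_iff by auto
  have "stereo_inf p * stereo p = (?a * ?b) / (of_real (1 - p$3) * of_real (1 + p$3))"
    unfolding stereo_def stereo_inf_def by (simp only: times_divide_times_eq mult.commute)
  also have "\<dots> = 1"
    unfolding ab by (rule divide_self) (use nz in \<open>simp only: mult_eq_0_iff, simp\<close>)
  finally show ?thesis by (metis inverse_unique mult.commute)
qed

section \<open>Calculus in a coordinate\<close>

definition pdx :: "(complex \<Rightarrow> 'b::real_normed_vector) \<Rightarrow> complex \<Rightarrow> 'b" where
  "pdx F w = frechet_derivative F (at w) 1"

definition pdy :: "(complex \<Rightarrow> 'b::real_normed_vector) \<Rightarrow> complex \<Rightarrow> 'b" where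
  "pdy F w = frechet_derivative F (at w) \<i>"

primrec diff_times :: "nat \<Rightarrow> complex set \<Rightarrow> (complex \<Rightarrow> 'b::real_normed_vector) \<Rightarrow> bool" where
  "diff_times 0 D F \<longleftrightarrow> continuous_on D F"
| "diff_times (Suc n) D F \<longleftrightarrow>
     (\<forall>w\<in>D. F differentiable (at w)) \<and> diff_times n D (pdx F) \<and> diff_times n D (pdy F)"

definition smooth_on :: "complex set \<Rightarrow> (complex \<Rightarrow> 'b::real_normed_vector) \<Rightarrow> bool" where
  "smooth_on D F \<longleftrightarrow> (\<forall>n. diff_times n D F)"

definition cvec :: "real^3 \<Rightarrow> complex^3" where
  "cvec v = (\<chi> k. complex_of_real (v$k))"

definition Re_vec :: "complex^3 \<Rightarrow> real^3" where
  "Re_vec v = (\<chi> k. Re (v$k))"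

definition bilin :: "complex^3 \<Rightarrow> complex^3 \<Rightarrow> complex" where
  "bilin u v = (\<Sum>k\<in>UNIV. u$k * v$k)"

definition d_z :: "(complex \<Rightarrow> complex^3) \<Rightarrow> complex \<Rightarrow> complex^3" where
  "d_z G w = (1/2) *s (pdx G w - \<i> *s pdy G w)"

definition d_zbar :: "(complex \<Rightarrow> complex^3) \<Rightarrow> complex \<Rightarrow> complex^3" where
  "d_zbar G w = (1/2) *s (pdx G w + \<i> *s pdy G w)"

section \<open>Non-conformal harmonic surfaces and their transforms\<close>

definition in_coord :: "('a \<Rightarrow> 'b) \<Rightarrow> 'a set \<Rightarrow> ('a \<Rightarrow> complex) \<Rightarrow> complex \<Rightarrow> 'b" where
  "in_coord f U z = f \<circ> inv_into U z"

definition harmonic_immersion :: "'a::t2_space set \<Rightarrow> 'a atlas \<Rightarrow> ('a \<Rightarrow> real^3) \<Rightarrow> bool" where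
  "harmonic_immersion M A f \<longleftrightarrow>
     (\<forall>(U, \<phi>)\<in>A. let F = in_coord f U \<phi> in
        smooth_on (\<phi> ` U) F \<and>
        (\<forall>w\<in>\<phi> ` U. inj (frechet_derivative F (at w)) \<and> d_zbar (d_z (cvec \<circ> F)) w = 0))"

definition nonconformal_harmonic_surface :: "'a::t2_space set \<Rightarrow> 'a atlas \<Rightarrow> ('a \<Rightarrow> real^3) \<Rightarrow> bool"
  where "nonconformal_harmonic_surface M A f \<longleftrightarrow>
     harmonic_immersion M A f \<and>
     (\<forall>(U, \<phi>)\<in>A. \<forall>w\<in>\<phi> ` U.
        bilin (d_z (cvec \<circ> in_coord f U \<phi>) w) (d_z (cvec \<circ> in_coord f U \<phi>) w) \<noteq> 0)"

definition adapted :: "'a set \<Rightarrow> ('a \<Rightarrow> complex) \<Rightarrow> ('a \<Rightarrow> real^3) \<Rightarrow> bool" where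
  "adapted U z f \<longleftrightarrow>
     (\<forall>w\<in>z ` U. bilin (d_z (cvec \<circ> in_coord f U z) w) (d_z (cvec \<circ> in_coord f U z) w) = -1)"

text \<open>
  The angle \<open>\<theta>\<close> and the transforms are determined by the partial derivatives \<open>X = f\<^sub>x\<close> and
  \<open>Y = f\<^sub>y\<close> in an adapted coordinate.  Since \<open>sin \<theta> > 0\<close>, the angle is normalised to lie
  between \<open>0\<close> and \<open>\<pi>\<close>, where it is unique.
\<close>

definition unit_normal :: "real^3 \<Rightarrow> real^3 \<Rightarrow> real^3" where
  "unit_normal X Y = cross3 X Y /\<^sub>R norm (cross3 X Y)"

definition angle :: "real^3 \<Rightarrow> real^3 \<Rightarrow> real" where
  "angle X Y =
     (THE \<theta>. 0 < \<theta> \<and> \<theta> < pi \<and> cos \<theta> = norm X / norm Y \<and> sin \<theta> = 2 / norm Y)"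

lemma angle_adapted:
  assumes "(norm Y)\<^sup>2 - (norm X)\<^sup>2 = 4"
  shows "cos (angle X Y) = norm X / norm Y" "sin (angle X Y) = 2 / norm Y"
proof -
  let ?P = "\<lambda>\<theta>. 0 < \<theta> \<and> \<theta> < pi \<and> cos \<theta> = norm X / norm Y \<and> sin \<theta> = 2 / norm Y"
  have Y: "norm Y > 0"
  proof -
    have "Y \<noteq> 0"
    proof
      assume "Y = 0"
      then have "- (norm X)\<^sup>2 = 4" using assms by simp
      then show False using zero_le_power2[of "norm X"] by linarith
    qed
    then show ?thesis by simp
  qed
  have "(norm X)\<^sup>2 < (norm Y)\<^sup>2" using assms by linarith
  then have "norm X < norm Y" by (rule power2_less_imp_less) simp
  then have c: "0 \<le> norm X / norm Y" "norm X / norm Y < 1" using Y by auto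
  have "1 - (norm X / norm Y)\<^sup>2 = ((norm Y)\<^sup>2 - (norm X)\<^sup>2) / (norm Y)\<^sup>2"
    using Y by (simp add: power_divide diff_divide_distrib)
  also have "\<dots> = (2 / norm Y)\<^sup>2"
    unfolding assms by (simp add: power_divide)
  finally have "1 - (norm X / norm Y)\<^sup>2 = (2 / norm Y)\<^sup>2" .
  then have "sqrt (1 - (norm X / norm Y)\<^sup>2) = 2 / norm Y"
    using Y by (simp only: real_sqrt_abs) simp
  moreover have "sin (arccos (norm X / norm Y)) = sqrt (1 - (norm X / norm Y)\<^sup>2)"
    using c by (intro sin_arccos) linarith+
  ultimately have "sin (arccos (norm X / norm Y)) = 2 / norm Y" by (rule trans[rotated])
  moreover have "0 < arccos (norm X / norm Y) \<and> arccos (norm X / norm Y) < pi"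
    using c by (intro arccos_lt_bounded) linarith+
  moreover have "cos (arccos (norm X / norm Y)) = norm X / norm Y"
    using c by (intro cos_arccos) linarith+
  ultimately have "?P (arccos (norm X / norm Y))" by blast
  moreover have "\<theta> = \<theta>'" if "?P \<theta>" "?P \<theta>'" for \<theta> \<theta>'
    using that cos_inj_pi[of \<theta> \<theta>'] by simp
  ultimately have "\<exists>!\<theta>. ?P \<theta>" by (intro ex1I[of _ "arccos (norm X / norm Y)"])
  then have "?P (angle X Y)"
    unfolding angle_def by (rule theI')
  then show "cos (angle X Y) = norm X / norm Y" "sin (angle X Y) = 2 / norm Y" by simp_all
qed

definition transform :: "real \<Rightarrow> 'a set \<Rightarrow> ('a \<Rightarrow> complex) \<Rightarrow> ('a \<Rightarrow> real^3) \<Rightarrow> 'a \<Rightarrow> real^3" where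
  "transform \<epsilon> U z f p =
     (let X = pdx (in_coord f U z) (z p); Y = pdy (in_coord f U z) (z p); \<theta> = angle X Y in
        (\<epsilon> * sin \<theta>) *\<^sub>R (Y /\<^sub>R norm Y) + cos \<theta> *\<^sub>R unit_normal X Y)"

section \<open>The representation formula\<close>

definition integrand :: "real^3 \<Rightarrow> real^3 \<Rightarrow> complex^3" where
  "integrand a b =
     complex_of_real (1 / (norm (a - b))\<^sup>2) *s (cvec (cross3 a b) - \<i> *s cvec (a - b))"

text \<open>
  \<open>f = 4 Re \<integral> integrand(g, h) dz\<close> on \<open>U\<close>.  The indefinite integral is a single-valued
  componentwise holomorphic primitive \<open>\<Phi>\<close> with respect to \<open>z\<close>, hence free up to
  a constant vector.
\<close>

definition given_by_formula ::
    "'a set \<Rightarrow> ('a \<Rightarrow> complex) \<Rightarrow> ('a \<Rightarrow> real^3) \<Rightarrow> ('a \<Rightarrow> real^3) \<Rightarrow> ('a \<Rightarrow> real^3) \<Rightarrow> bool" where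
  "given_by_formula U z g h f \<longleftrightarrow>
     (\<exists>\<Phi> :: complex \<Rightarrow> complex^3.
        (\<forall>w\<in>z ` U. \<forall>k. ((\<lambda>w. \<Phi> w $ k) has_field_derivative
           integrand (in_coord g U z w) (in_coord h U z w) $ k) (at w)) \<and>
        (\<forall>p\<in>U. f p = 4 *\<^sub>R Re_vec (\<Phi> (z p))))"

end

theory Submission
  imports Defs "HOL-Complex_Analysis.Riemann_Mapping"
begin

text \<open>
  In an adapted coordinate write \<open>X = f\<^sub>x\<close> and \<open>Y = f\<^sub>y\<close>, so that \<open>X \<bullet> Y = 0\<close> and
  \<open>|Y|\<^sup>2 = |X|\<^sup>2 + 4\<close>.  Orthogonality gives \<open>|X \<times> Y| = |X| |Y|\<close>, which makes the angle disappear from the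
  transforms: \<open>f\<^sup>+ = (X \<times> Y + 2Y)/|Y|\<^sup>2\<close> and \<open>f\<^sup>- = (X \<times> Y - 2Y)/|Y|\<^sup>2\<close>.  Pointwise, this is a bijection
  from the frames \<open>(X, Y)\<close> with \<open>X \<noteq> 0\<close> to the pairs \<open>(g, h)\<close> of unit vectors with \<open>g \<noteq> h\<close> and \<open>g \<noteq> -h\<close>,
  and its inverse is \<open>X = 4 (g \<times> h)/|g - h|\<^sup>2\<close>, \<open>Y = 4 (g - h)/|g - h|\<^sup>2\<close>.  In other words
  \<open>X - iY = 2 f\<^sub>z\<close> is four times the integrand of the representation formula, and the formula says
  exactly that \<open>f\<close> has the transforms \<open>g\<close> and \<open>h\<close> (lemmas \<open>frame_of_sphere_pair\<close> and
  \<open>integrand_frame_transform\<close>).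

  It remains to see that \<open>\<phi> = f\<^sub>z\<close> is holomorphic if and only if \<open>g\<close> and \<open>h\<close> are.  The equation
  \<open>\<langle>\<phi>, \<phi>\<rangle> = -1\<close> factors as
  \<open>(i\<phi>\<^sub>3 + 1)(i\<phi>\<^sub>3 - 1) = (\<phi>\<^sub>1 + i\<phi>\<^sub>2)(\<phi>\<^sub>1 - i\<phi>\<^sub>2)\<close>, and both resulting expressions for one ratio are
  homogeneous coordinates of \<open>g\<close> on the Riemann sphere:
  \<open>(i\<phi>\<^sub>3 + 1 : i\<phi>\<^sub>1 + \<phi>\<^sub>2) = (\<phi>\<^sub>1 + i\<phi>\<^sub>2 : -\<phi>\<^sub>3 - i)\<close>.  Those of \<open>h\<close> are the same with \<open>-\<phi>\<close> in place of
  \<open>\<phi>\<close> (lemma \<open>spinor_of_frame_transform\<close>).  So \<open>g\<close> and \<open>h\<close> are holomorphic if \<open>\<phi>\<close> is.  Conversely,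
  if \<open>(p\<^sub>0 : p\<^sub>1)\<close> and \<open>(q\<^sub>0 : q\<^sub>1)\<close> are holomorphic homogeneous coordinates of \<open>g\<close> and \<open>h\<close>, these
  proportions are linear equations for \<open>\<phi>\<close>, and their solution is polynomial in the \<open>p\<^sub>j\<close> and \<open>q\<^sub>j\<close>
  divided by \<open>p\<^sub>0q\<^sub>1 - q\<^sub>0p\<^sub>1\<close>, which has no zero since \<open>g \<noteq> h\<close> (lemma \<open>integrand_of_spinors\<close>).

  Given \<open>g\<close> and \<open>h\<close>, the integrand is therefore holomorphic, and it has a primitive because the
  coordinate image of \<open>M\<close> is simply connected.  Given \<open>f\<close>, the function \<open>-\<langle>f\<^sub>z, f\<^sub>z\<rangle>\<close> of a chart has a
  holomorphic square root \<open>s\<close> near a given point; a primitive of \<open>s\<close> is an adapted coordinate there,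
  and the transforms in it are the required \<open>g\<close> and \<open>h\<close>, with \<open>X \<noteq> 0\<close> because \<open>f\<close> is an immersion.
\<close>

section \<open>Adapted frames and pairs of points of the sphere\<close>

text \<open>
  The partial derivatives \<open>X = f\<^sub>x\<close> and \<open>Y = f\<^sub>y\<close> in a coordinate form such a pair exactly when the
  coordinate is adapted to \<open>f\<close>.
\<close>

definition adapted_frame :: "real^3 \<Rightarrow> real^3 \<Rightarrow> bool" where
  "adapted_frame X Y \<longleftrightarrow> X \<bullet> Y = 0 \<and> Y \<bullet> Y = X \<bullet> X + 4"

text \<open>
  The \<open>+\<close> transform, with the angle eliminated.  Reversing both vectors keeps \<open>X \<times> Y\<close> and the norms
  but changes the sign of the term \<open>2Y\<close>, so the \<open>-\<close> transform is \<open>frame_transform (-X) (-Y)\<close>.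
\<close>

definition frame_transform :: "real^3 \<Rightarrow> real^3 \<Rightarrow> real^3" where
  "frame_transform X Y = (2 *\<^sub>R Y + cross3 X Y) /\<^sub>R (Y \<bullet> Y)"

lemma adapted_frame_minus [simp]: "adapted_frame (- X) (- Y) \<longleftrightarrow> adapted_frame X Y"
  by (simp add: adapted_frame_def)

lemma adapted_frame_pos: "adapted_frame X Y \<Longrightarrow> Y \<bullet> Y > 0"
  unfolding adapted_frame_def by (smt (verit) inner_ge_zero)

text \<open>
  Since \<open>Y\<close> and \<open>X \<times> Y\<close> are orthogonal, the squared norm of the numerator is
  \<open>4 |Y|\<^sup>2 + |X|\<^sup>2 |Y|\<^sup>2 = |Y|\<^sup>4\<close>.
\<close>

lemma frame_transform_in_S2:
  assumes "adapted_frame X Y"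
  shows "frame_transform X Y \<in> S2"
proof -
  have n: "Y \<bullet> Y > 0" by (rule adapted_frame_pos[OF assms])
  have "(2 *\<^sub>R Y + cross3 X Y) \<bullet> (2 *\<^sub>R Y + cross3 X Y) = 4 * (Y \<bullet> Y) + cross3 X Y \<bullet> cross3 X Y"
    by (simp add: algebra_simps dot_cross_self)
  also have "\<dots> = (Y \<bullet> Y) * (Y \<bullet> Y)"
    using assms unfolding dot_cross adapted_frame_def by (simp add: inner_commute algebra_simps)
  finally have "(norm (2 *\<^sub>R Y + cross3 X Y))\<^sup>2 = (Y \<bullet> Y)\<^sup>2"
    unfolding power2_norm_eq_inner by (simp add: power2_eq_square)
  then have "norm (2 *\<^sub>R Y + cross3 X Y) = Y \<bullet> Y"
    using n by (simp add: power2_eq_iff_nonneg)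
  then show ?thesis using n by (simp add: frame_transform_def)
qed

text \<open>
  Since \<open>|X \<times> Y| = |X| |Y|\<close>, the term \<open>(cos \<theta>) N\<close> is \<open>(|X|/|Y|) (X \<times> Y)/(|X| |Y|) = (X \<times> Y)/|Y|\<^sup>2\<close>.
\<close>

lemma transform_eq_frame_transform:
  assumes "adapted_frame X Y" "X \<noteq> 0"
    and "X = pdx (in_coord f U z) (z p)" "Y = pdy (in_coord f U z) (z p)"
  shows "transform 1 U z f p = frame_transform X Y"
    and "transform (-1) U z f p = frame_transform (-X) (-Y)"
proof -
  have n: "Y \<bullet> Y > 0" by (rule adapted_frame_pos[OF assms(1)])
  have Y: "norm Y \<noteq> 0" "norm X \<noteq> 0" "Y \<bullet> Y = norm Y * norm Y"
    using n assms(2) by (auto simp flip: power2_norm_eq_inner simp: power2_eq_square)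
  have "(norm Y)\<^sup>2 - (norm X)\<^sup>2 = 4"
    using assms(1) by (simp add: adapted_frame_def power2_norm_eq_inner)
  note an = angle_adapted[OF this]
  have "(norm (cross3 X Y))\<^sup>2 = (norm X * norm Y)\<^sup>2"
    using assms(1) by (simp add: norm_cross adapted_frame_def power_mult_distrib)
  then have c: "norm (cross3 X Y) = norm X * norm Y"
    by (simp add: power2_eq_iff_nonneg)
  have *: "(e * (2 / norm Y)) *\<^sub>R (Y /\<^sub>R norm Y) + (norm X / norm Y) *\<^sub>R (cross3 X Y /\<^sub>R (norm X * norm Y))
     = ((2*e) *\<^sub>R Y + cross3 X Y) /\<^sub>R (Y \<bullet> Y)" for e
    unfolding Y(3) using Y(1,2) by (simp add: scaleR_add_right field_simps)
  show "transform 1 U z f p = frame_transform X Y"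
    and "transform (-1) U z f p = frame_transform (-X) (-Y)"
    unfolding transform_def Let_def frame_transform_def unit_normal_def assms(3,4)[symmetric] an c *
    by simp_all
qed

lemma
  assumes "adapted_frame X Y"
  shows frame_transform_diff: "frame_transform X Y - frame_transform (-X) (-Y) = (4 / (Y \<bullet> Y)) *\<^sub>R Y"
    and frame_transform_diff_nonzero: "frame_transform X Y - frame_transform (-X) (-Y) \<noteq> 0"
    and frame_transform_sum_nonzero: "X \<noteq> 0 \<Longrightarrow> frame_transform X Y + frame_transform (-X) (-Y) \<noteq> 0"
proof -
  have n: "Y \<bullet> Y > 0" by (rule adapted_frame_pos[OF assms(1)])
  show d: "frame_transform X Y - frame_transform (-X) (-Y) = (4 / (Y \<bullet> Y)) *\<^sub>R Y"
    unfolding frame_transform_def by (simp add: vec_eq_iff field_simps)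
  then show "frame_transform X Y - frame_transform (-X) (-Y) \<noteq> 0" using n by auto
  assume "X \<noteq> 0"
  have "frame_transform X Y + frame_transform (-X) (-Y) = (2 / (Y \<bullet> Y)) *\<^sub>R cross3 X Y"
    unfolding frame_transform_def by (simp add: vec_eq_iff field_simps)
  moreover have "cross3 X Y \<bullet> cross3 X Y = (X \<bullet> X) * (Y \<bullet> Y)"
    using assms unfolding dot_cross adapted_frame_def by (simp add: inner_commute)
  then have "cross3 X Y \<noteq> 0" using n \<open>X \<noteq> 0\<close> by auto
  ultimately show "frame_transform X Y + frame_transform (-X) (-Y) \<noteq> 0" using n by simp
qed

text \<open>
  The integrand in the form \<open>A - iB\<close> with real vectors \<open>A\<close> and \<open>B\<close>, which is to be compared with
  \<open>X - iY\<close>.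
\<close>

lemma integrand_alt:
  "integrand a b = cvec (cross3 a b /\<^sub>R ((a-b) \<bullet> (a-b))) - \<i> *s cvec ((a-b) /\<^sub>R ((a-b) \<bullet> (a-b)))"
  unfolding integrand_def cvec_def power2_norm_eq_inner
  by (simp add: vec_eq_iff divide_inverse algebra_simps)

text \<open>
  With \<open>g\<close> and \<open>h\<close> the two transforms, \<open>g - h = 4Y/|Y|\<^sup>2\<close>, and \<open>Y \<times> (X \<times> Y) = |Y|\<^sup>2 X\<close> gives
  \<open>g \<times> h = 4X/|Y|\<^sup>2\<close>.
\<close>

lemma integrand_frame_transform:
  assumes "adapted_frame X Y"
  shows "integrand (frame_transform X Y) (frame_transform (-X) (-Y)) =
           (1/4) *s (cvec X - \<i> *s cvec Y)"
proof -
  let ?g = "frame_transform X Y" and ?h = "frame_transform (-X) (-Y)"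
  have n: "Y \<bullet> Y > 0" by (rule adapted_frame_pos[OF assms(1)])
  have d: "?g - ?h = (4 / (Y \<bullet> Y)) *\<^sub>R Y" by (rule frame_transform_diff[OF assms])
  then have dd: "(?g - ?h) \<bullet> (?g - ?h) = 16 / (Y \<bullet> Y)" using n by simp
  have "cross3 (cross3 X Y) Y = - ((Y \<bullet> Y) *\<^sub>R X)"
    using assms cross_skew[of "cross3 X Y" Y] unfolding Lagrange adapted_frame_def
    by (simp add: inner_commute)
  then have c: "cross3 Y (cross3 X Y) = (Y \<bullet> Y) *\<^sub>R X"
    by (subst cross_skew) (simp add: scaleR_minus_left)
  have "cross3 (r *\<^sub>R (2 *\<^sub>R Y + Z)) (r *\<^sub>R (2 *\<^sub>R (-Y) + Z)) = (4 * r\<^sup>2) *\<^sub>R cross3 Y Z"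
    for r :: real and Z
    by (simp add: vec_eq_iff forall_3 cross_components power2_eq_square algebra_simps)
  from this[of "inverse (Y \<bullet> Y)" "cross3 X Y"]
  have "cross3 ?g ?h = (4 / (Y \<bullet> Y)\<^sup>2) *\<^sub>R cross3 Y (cross3 X Y)"
    unfolding frame_transform_def by (simp add: power_inverse divide_inverse)
  then have "cross3 ?g ?h = (4 / (Y \<bullet> Y)) *\<^sub>R X"
    unfolding c using n by (simp add: power2_eq_square)
  then show ?thesis
    unfolding integrand_alt dd d using n
    by (simp add: cvec_def vec_eq_iff field_simps)
qed

text \<open>
  The inverse of the passage from a frame to its two transforms.  With \<open>t = a \<bullet> b\<close> one has
  \<open>|X|\<^sup>2 = 4(1 + t)/(1 - t)\<close> and \<open>|Y|\<^sup>2 = 8/(1 - t)\<close>, whence the difference \<open>4\<close>, and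
  \<open>(a \<times> b) \<times> (a - b) = (1 - t)(a + b)\<close> gives \<open>(X \<times> Y)/|Y|\<^sup>2 = (a + b)/2\<close>, while
  \<open>2Y/|Y|\<^sup>2 = (a - b)/2\<close>.
\<close>

lemma frame_of_sphere_pair:
  assumes "a \<in> S2" "b \<in> S2" "a - b \<noteq> 0" "a + b \<noteq> 0"
  defines "d \<equiv> (a - b) \<bullet> (a - b)"
  defines "X \<equiv> (4 / d) *\<^sub>R cross3 a b" and "Y \<equiv> (4 / d) *\<^sub>R (a - b)"
  shows "adapted_frame X Y" "X \<noteq> 0" "frame_transform X Y = a" "frame_transform (-X) (-Y) = b"
    "integrand a b = (1/4) *s (cvec X - \<i> *s cvec Y)"
proof -
  define t where "t = a \<bullet> b"
  have ab: "a \<bullet> a = 1" "b \<bullet> b = 1" "b \<bullet> a = t" "a \<bullet> b = t"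
    using assms(1,2) by (auto simp: t_def inner_commute norm_eq_1)
  have d: "d = 2 - 2 * t"
    unfolding d_def by (simp add: inner_diff_left inner_diff_right ab)
  have d0: "d > 0"
    using assms(3) unfolding d_def by (simp only: inner_gt_zero_iff) simp
  note d = d d0
  have "(a + b) \<bullet> (a + b) > 0" using assms(4) by simp
  then have t: "1 + t > 0" by (simp add: inner_add_left inner_add_right ab)
  have cc: "cross3 a b \<bullet> cross3 a b = d * (1 + t) / 2"
    unfolding dot_cross by (simp add: ab d algebra_simps)
  have YY: "Y \<bullet> Y = 16 / d" using d(2) unfolding Y_def d_def by simp
  have XX: "X \<bullet> X = 8 * (1 + t) / d" using d(2) unfolding X_def by (simp add: cc field_simps)
  have "16 = 8 * (1 + t) + 4 * d" by (simp add: d)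
  then have "Y \<bullet> Y = X \<bullet> X + 4" unfolding XX YY using d(2) by (simp add: field_simps)
  moreover have "X \<bullet> Y = 0"
    unfolding X_def Y_def by (simp add: inner_diff_right dot_cross_self)
  ultimately show "adapted_frame X Y" by (simp add: adapted_frame_def)
  show "X \<noteq> 0" using XX d(2) t by auto
  have "cross3 (a - b) (cross3 a b) = - ((1 - t) *\<^sub>R (a + b))"
    unfolding Lagrange by (simp add: ab inner_diff_left vec_eq_iff algebra_simps)
  then have "cross3 (cross3 a b) (a - b) = (d / 2) *\<^sub>R (a + b)"
    unfolding cross_skew[of "cross3 a b" "a - b"] by (simp only: minus_minus) (simp add: d)
  then have XY: "cross3 X Y = (8 / d) *\<^sub>R (a + b)"
    unfolding X_def Y_def cross_mult_left cross_mult_right using d(2) by simp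
  show "frame_transform X Y = a"
    unfolding frame_transform_def XY YY using d(2) by (simp add: Y_def vec_eq_iff field_simps)
  show "frame_transform (-X) (-Y) = b"
    unfolding frame_transform_def using d(2) by (simp add: XY YY) (simp add: Y_def vec_eq_iff field_simps)
  show "integrand a b = (1/4) *s (cvec X - \<i> *s cvec Y)"
    unfolding integrand_alt X_def Y_def d_def[symmetric] cvec_def by (simp add: vec_eq_iff field_simps)
qed

lemma bilin_scale: "bilin (a *s u) (b *s v) = a * b * bilin u v"
  by (simp add: bilin_def sum_3 algebra_simps)

lemma cvec_Re_vec: "cvec (Re_vec c) - \<i> *s cvec (Re_vec (\<i> *s c)) = c"
  by (simp add: cvec_def Re_vec_def vec_eq_iff complex_eq_iff)

text \<open>
  The real and imaginary parts of \<open>\<langle>X - iY, X - iY\<rangle>\<close> are \<open>|X|\<^sup>2 - |Y|\<^sup>2\<close> and \<open>-2 X \<bullet> Y\<close>.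
\<close>

lemma adapted_frame_iff_bilin:
  "adapted_frame X Y \<longleftrightarrow> bilin (cvec X - \<i> *s cvec Y) (cvec X - \<i> *s cvec Y) = -4"
  unfolding adapted_frame_def bilin_def inner_vec_def sum_3 complex_eq_iff
  by (auto simp: cvec_def algebra_simps)

text \<open>
  With \<open>t = va\<close>, the vector is \<open>(Re t) X + (Im t) Y\<close>, and \<open>X\<close>, \<open>Y\<close> are orthogonal and nonzero.  This is
  the immersion condition in an arbitrary chart, \<open>a\<close> being the derivative of the coordinate change.
\<close>

lemma inj_frame:
  assumes "adapted_frame X Y" "X \<noteq> 0" "a \<noteq> 0"
  shows "inj (\<lambda>v. Re_vec (v *s (a *s (cvec X - \<i> *s cvec Y))))"
proof (rule injI)
  fix u v assume uv: "Re_vec (u *s (a *s (cvec X - \<i> *s cvec Y))) = Re_vec (v *s (a *s (cvec X - \<i> *s cvec Y)))"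
  define t where "t = (u - v) * a"
  have "Re t *\<^sub>R X + Im t *\<^sub>R Y
      = Re_vec (u *s (a *s (cvec X - \<i> *s cvec Y))) - Re_vec (v *s (a *s (cvec X - \<i> *s cvec Y)))"
    by (simp add: t_def Re_vec_def cvec_def vec_eq_iff algebra_simps)
  then have *: "Re t *\<^sub>R X + Im t *\<^sub>R Y = 0" using uv by simp
  have "(Re t *\<^sub>R X + Im t *\<^sub>R Y) \<bullet> X = Re t * (X \<bullet> X)" "(Re t *\<^sub>R X + Im t *\<^sub>R Y) \<bullet> Y = Im t * (Y \<bullet> Y)"
    using assms(1) by (simp_all add: inner_add_left adapted_frame_def inner_commute[of Y X])
  then have "t = 0"
    using assms(2) adapted_frame_pos[OF assms(1)] unfolding * by (auto simp: complex_eq_iff)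
  then show "u = v" using assms(3) by (simp add: t_def)
qed

section \<open>Homogeneous coordinates on the sphere\<close>

text \<open>
  For a unit vector \<open>v\<close> and \<open>(p, q) \<noteq> 0\<close> this says that \<open>(p : q)\<close> are homogeneous coordinates of the
  image of \<open>v\<close> in the projective line, i.e. \<open>stereo v = p / q\<close>.  The two equations come from the two
  affine charts; away from the poles each implies the other, and at a pole only one of them carries
  information.  Nonvanishing is a separate condition, because the explicit coordinates of a transform
  may both vanish at some points.
\<close>

definition spinor_of :: "complex \<Rightarrow> complex \<Rightarrow> real^3 \<Rightarrow> bool" where
  "spinor_of p q v \<longleftrightarrow>
     p * of_real (1 - v$3) = q * Complex (v$1) (v$2) \<and>
     p * Complex (v$1) (- v$2) = q * of_real (1 + v$3)"

lemma S2_components: "v \<in> S2 \<longleftrightarrow> (v$1)\<^sup>2 + (v$2)\<^sup>2 + (v$3)\<^sup>2 = 1"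
  by (simp add: norm_eq_1 inner_vec_def sum_3 power2_eq_square)

lemma spinor_of_stereo:
  assumes "v \<in> S2" "v$3 \<noteq> 1"
  shows "spinor_of (stereo v) 1 v"
proof -
  have s: "v$1 * v$1 + v$2 * v$2 = (1 + v$3) * (1 - v$3)"
    using assms(1)[unfolded S2_components] by (simp add: power2_eq_square algebra_simps)
  have "Complex (v$1) (v$2) * Complex (v$1) (- v$2) = of_real (1 + v$3) * of_real (1 - v$3)"
    using s by (simp add: complex_eq_iff)
  moreover have "of_real (1 - v$3) \<noteq> (0::complex)" using assms(2) unfolding of_real_eq_0_iff by simp
  ultimately show ?thesis unfolding spinor_of_def stereo_def by simp
qed

lemma spinor_of_stereo_inf:
  assumes "v \<in> S2" "v$3 \<noteq> -1"
  shows "spinor_of 1 (stereo_inf v) v"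
proof -
  have s: "v$1 * v$1 + v$2 * v$2 = (1 - v$3) * (1 + v$3)"
    using assms(1)[unfolded S2_components] by (simp add: power2_eq_square algebra_simps)
  have "Complex (v$1) (- v$2) * Complex (v$1) (v$2) = of_real (1 - v$3) * of_real (1 + v$3)"
    using s by (simp add: complex_eq_iff)
  moreover have "of_real (1 + v$3) \<noteq> (0::complex)" using assms(2) unfolding of_real_eq_0_iff by simp
  ultimately show ?thesis unfolding spinor_of_def stereo_inf_def by simp
qed

lemma stereo_of_spinor:
  assumes "spinor_of p q v" "p \<noteq> 0 \<or> q \<noteq> 0" "v$3 \<noteq> 1"
  shows "q \<noteq> 0" "stereo v = p / q"
proof -
  have n: "of_real (1 - v$3) \<noteq> (0::complex)" using assms(3) unfolding of_real_eq_0_iff by simp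
  show q: "q \<noteq> 0"
  proof
    assume "q = 0"
    then have "p * of_real (1 - v$3) = 0" using assms(1) by (simp add: spinor_of_def)
    then show False using n \<open>q = 0\<close> assms(2) by simp
  qed
  show "stereo v = p / q"
    using assms(1) n q unfolding spinor_of_def stereo_def by (simp add: field_simps)
qed

lemma stereo_inf_of_spinor:
  assumes "spinor_of p q v" "p \<noteq> 0 \<or> q \<noteq> 0" "v$3 \<noteq> -1"
  shows "p \<noteq> 0" "stereo_inf v = q / p"
proof -
  have n: "of_real (1 + v$3) \<noteq> (0::complex)" using assms(3) unfolding of_real_eq_0_iff by simp
  show q: "p \<noteq> 0"
  proof
    assume "p = 0"
    then have "q * of_real (1 + v$3) = 0" using assms(1) by (simp add: spinor_of_def)
    then show False using n \<open>p = 0\<close> assms(2) by simp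
  qed
  show "stereo_inf v = q / p"
    using assms(1) n q unfolding spinor_of_def stereo_inf_def by (simp add: field_simps)
qed

lemma spinor_of_proportional:
  assumes "spinor_of p q v" "spinor_of p' q' v"
  shows "p * q' = p' * q"
proof (cases "v$3 = 1")
  case False
  then have n: "of_real (1 - v$3) \<noteq> (0::complex)" unfolding of_real_eq_0_iff by simp
  have "(p * q') * of_real (1 - v$3) = (p * of_real (1 - v$3)) * q'" by (simp add: mult_ac)
  also have "\<dots> = q * (q' * Complex (v$1) (v$2))"
    using assms(1) unfolding spinor_of_def by simp
  also have "\<dots> = q * (p' * of_real (1 - v$3))"
    using assms(2) unfolding spinor_of_def by simp
  finally show ?thesis using n by (simp add: mult_ac)
next
  case True
  then have n: "of_real (1 + v$3) \<noteq> (0::complex)" by simp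
  have "(p * q') * of_real (1 + v$3) = p * (q' * of_real (1 + v$3))" by (simp add: mult_ac)
  also have "\<dots> = p' * (p * Complex (v$1) (- v$2))"
    using assms(2) unfolding spinor_of_def by simp
  also have "\<dots> = p' * (q * of_real (1 + v$3))"
    using assms(1) unfolding spinor_of_def by simp
  finally show ?thesis using n by (simp add: mult_ac)
qed

text \<open>
  After multiplication by \<open>|Y|\<^sup>2\<close> these are polynomial identities in the six components of \<open>X\<close> and \<open>Y\<close>,
  modulo the two equations of an adapted frame.  Each of the two pairs of coordinates may vanish, but
  never both, since \<open>i\<phi>\<^sub>3 + 1\<close> and \<open>i\<phi>\<^sub>3 - 1 = -i(-\<phi>\<^sub>3 - i)\<close> have no common zero.
\<close>

lemma spinor_of_frame_transform:
  fixes X Y :: "real^3"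
  assumes "adapted_frame X Y"
  defines "\<phi> \<equiv> (1/2) *s (cvec X - \<i> *s cvec Y)"
  shows "spinor_of (\<i> * \<phi>$3 + 1) (\<i> * \<phi>$1 + \<phi>$2) (frame_transform X Y)" (is ?A)
    and "spinor_of (\<phi>$1 + \<i> * \<phi>$2) (- \<phi>$3 - \<i>) (frame_transform X Y)" (is ?B)
proof -
  define x1 x2 x3 y1 y2 y3 n where x: "x1 = X$1" "x2 = X$2" "x3 = X$3" "y1 = Y$1" "y2 = Y$2" "y3 = Y$3"
    "n = Y \<bullet> Y"
  have n: "n > 0" using adapted_frame_pos[OF assms(1)] x by simp
  have nn: "n = y1*y1+y2*y2+y3*y3" and 1: "n = x1*x1+x2*x2+x3*x3+4" and 2: "x1*y1+x2*y2+x3*y3 = 0"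
    using assms(1) x unfolding adapted_frame_def inner_vec_def sum_3 by simp_all
  have v: "frame_transform X Y $ 1 = (2 * y1 + (x2*y3-y2*x3)) / n"
     "frame_transform X Y $ 2 = (2 * y2 + (x3*y1-y3*x1)) / n"
     "frame_transform X Y $ 3 = (2 * y3 + (x1*y2-y1*x2)) / n"
    unfolding frame_transform_def x by (simp_all add: cross_components divide_inverse mult.commute)
  have p: "\<phi>$1 = Complex (x1/2) (-y1/2)" "\<phi>$2 = Complex (x2/2) (-y2/2)" "\<phi>$3 = Complex (x3/2) (-y3/2)"
    unfolding \<phi>_def cvec_def x by (simp_all add: complex_eq_iff)
  show ?A
    unfolding spinor_of_def v p using n
    apply (simp add: complex_eq_iff field_simps)
    using nn 1 2 
    apply (intro conjI; algebra)
    done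
  show ?B
    unfolding spinor_of_def v p using n
    apply (simp add: complex_eq_iff field_simps)
    using nn 1 2 
    apply (intro conjI; algebra)
    done
qed

text \<open>
  Put \<open>\<alpha> = i\<phi>\<^sub>1 + \<phi>\<^sub>2\<close>, \<open>\<beta> = i\<phi>\<^sub>3\<close>, \<open>\<gamma> = \<phi>\<^sub>1 + i\<phi>\<^sub>2\<close>, where \<open>\<phi>\<close> is twice the integrand.  Comparing the
  given homogeneous coordinates with those of \<open>spinor_of_frame_transform\<close> gives
  \<open>p\<^sub>0\<alpha> = p\<^sub>1(\<beta> + 1)\<close>, \<open>q\<^sub>0\<alpha> = q\<^sub>1(\<beta> - 1)\<close> and two similar equations with \<open>\<gamma>\<close>.  Eliminating yields
  \<open>\<Delta>\<alpha> = 2p\<^sub>1q\<^sub>1\<close>, \<open>\<Delta>\<beta> = p\<^sub>0q\<^sub>1 + p\<^sub>1q\<^sub>0\<close> and \<open>\<Delta>\<gamma> = 2ip\<^sub>0q\<^sub>0\<close>; if \<open>\<Delta>\<close> were zero, all four products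
  \<open>p\<^sub>jq\<^sub>k\<close> would vanish.
\<close>

lemma integrand_of_spinors:
  assumes S: "a \<in> S2" "b \<in> S2" "a - b \<noteq> 0" "a + b \<noteq> 0"
    and p: "spinor_of p0 p1 a" "p0 \<noteq> 0 \<or> p1 \<noteq> 0"
    and q: "spinor_of q0 q1 b" "q0 \<noteq> 0 \<or> q1 \<noteq> 0"
  defines "\<Delta> \<equiv> p0 * q1 - q0 * p1"
  shows "\<Delta> \<noteq> 0"
    and "integrand a b $ 1 = \<i> * (p0 * q0 - p1 * q1) / (2 * \<Delta>)"
    and "integrand a b $ 2 = (p0 * q0 + p1 * q1) / (2 * \<Delta>)"
    and "integrand a b $ 3 = - \<i> * (p0 * q1 + p1 * q0) / (2 * \<Delta>)"
proof -
  define d where "d = (a - b) \<bullet> (a - b)"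
  define X Y where "X = (4 / d) *\<^sub>R cross3 a b" and "Y = (4 / d) *\<^sub>R (a - b)"
  note fr = frame_of_sphere_pair[OF S, folded d_def, folded X_def Y_def]
  define \<phi> where "\<phi> = (1/2) *s (cvec X - \<i> *s cvec Y)"
  have neg: "(1/2) *s (cvec (- X) - \<i> *s cvec (- Y)) = - \<phi>"
    unfolding \<phi>_def by (simp add: cvec_def vec_eq_iff)
  have integ: "integrand a b $ k = \<phi> $ k / 2" for k
    unfolding fr(5) \<phi>_def by simp
  define \<alpha> \<beta> \<gamma> where abc: "\<alpha> = \<i> * \<phi>$1 + \<phi>$2" "\<beta> = \<i> * \<phi>$3" "\<gamma> = \<phi>$1 + \<i> * \<phi>$2"
  have \<phi>: "\<phi>$1 = (\<gamma> - \<i> * \<alpha>) / 2" "\<phi>$2 = (\<alpha> - \<i> * \<gamma>) / 2" "\<phi>$3 = - \<i> * \<beta>"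
    unfolding abc by (simp_all add: algebra_simps)
  have "spinor_of (\<beta> + 1) \<alpha> a" "spinor_of \<gamma> (\<i> * (\<beta> - 1)) a"
    using spinor_of_frame_transform[OF fr(1)] unfolding fr(3) \<phi>_def[symmetric] abc
    by (simp_all add: algebra_simps)
  then have 1: "p0 * \<alpha> = (\<beta> + 1) * p1" "p0 * (\<i> * (\<beta> - 1)) = \<gamma> * p1"
    using spinor_of_proportional[OF p(1)] by blast+
  have "adapted_frame (- X) (- Y)" using fr(1) by simp
  note fn = spinor_of_frame_transform[OF this]
  have "spinor_of (1 - \<beta>) (- \<alpha>) b" "spinor_of (- \<gamma>) (- (\<i> * (\<beta> + 1))) b"
    using fn unfolding fr(4) neg abc by (simp_all add: algebra_simps)
  then have 2: "q0 * - \<alpha> = (1 - \<beta>) * q1" "q0 * - (\<i> * (\<beta> + 1)) = - \<gamma> * q1"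
    using spinor_of_proportional[OF q(1)] by blast+
  have A: "\<Delta> * \<alpha> = 2 * p1 * q1" using 1 2 unfolding \<Delta>_def by algebra
  have B: "\<Delta> * \<beta> = p0 * q1 + p1 * q0" using 1 2 unfolding \<Delta>_def by algebra
  have C: "\<Delta> * \<gamma> = 2 * \<i> * p0 * q0"
    using 1(2) 2(2) i_squared unfolding \<Delta>_def by algebra
  show D: "\<Delta> \<noteq> 0"
  proof
    assume 0: "\<Delta> = 0"
    have "p1 * q1 = 0" "p0 * q0 = 0" "p0 * q1 + p1 * q0 = 0" using A B C 0 by simp_all
    moreover have "p0 * q1 = q0 * p1" using 0 by (simp add: \<Delta>_def)
    ultimately show False using p(2) q(2) by auto
  qed
  have ABC: "\<alpha> = 2 * p1 * q1 / \<Delta>" "\<beta> = (p0 * q1 + p1 * q0) / \<Delta>" "\<gamma> = 2 * \<i> * p0 * q0 / \<Delta>"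
    using A B C D by (simp_all add: field_simps)
  show "integrand a b $ 1 = \<i> * (p0 * q0 - p1 * q1) / (2 * \<Delta>)"
    and "integrand a b $ 2 = (p0 * q0 + p1 * q1) / (2 * \<Delta>)"
    and "integrand a b $ 3 = - \<i> * (p0 * q1 + p1 * q0) / (2 * \<Delta>)"
    unfolding integ \<phi> ABC using D by (simp_all add: field_simps)
qed

section \<open>Harmonic maps as real parts of holomorphic curves\<close>

lemma has_derivative_vec_componentwise:
  fixes f :: "'a::euclidean_space \<Rightarrow> 'b::real_normed_vector ^ 'n"
  shows "(f has_derivative f') (at x) \<longleftrightarrow> (\<forall>k. ((\<lambda>x. f x $ k) has_derivative (\<lambda>v. f' v $ k)) (at x))"
proof
  assume "(f has_derivative f') (at x)"
  then show "\<forall>k. ((\<lambda>x. f x $ k) has_derivative (\<lambda>v. f' v $ k)) (at x)"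
    using bounded_linear.has_derivative[OF bounded_linear_vec_nth] by blast
next
  assume k: "\<forall>k. ((\<lambda>x. f x $ k) has_derivative (\<lambda>v. f' v $ k)) (at x)"
  then have l: "linear (\<lambda>v. f' v $ k)" for k
    using has_derivative_linear by blast
  have "linear f'"
    by (intro linearI) (auto simp: vec_eq_iff linear_add[OF l] linear_scale[OF l])
  moreover have "((\<lambda>y. (f y - f x - f' (y - x)) /\<^sub>R norm (y - x)) \<longlongrightarrow> 0) (at x)"
  proof (rule vec_tendstoI)
    fix i
    show "((\<lambda>y. ((f y - f x - f' (y - x)) /\<^sub>R norm (y - x)) $ i) \<longlongrightarrow> 0 $ i) (at x)"
      using k[rule_format, of i] unfolding has_derivative_at_within by simp
  qed
  ultimately show "(f has_derivative f') (at x)"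
    unfolding has_derivative_at_within by (simp add: linear_conv_bounded_linear)
qed

lemma linear_complex_eq:
  assumes "linear L"
  shows "L v = Re v *\<^sub>R L 1 + Im v *\<^sub>R L \<i>"
proof -
  have "L v = L (Re v *\<^sub>R 1 + Im v *\<^sub>R \<i>)" by (rule arg_cong) (simp add: complex_eq_iff)
  then show ?thesis by (simp only: linear_add[OF assms] linear_scale[OF assms])
qed

lemma pdx_pdy_eqI:
  assumes "(F has_derivative L) (at w)"
  shows "pdx F w = L 1" "pdy F w = L \<i>"
  using frechet_derivative_at[OF assms] unfolding pdx_def pdy_def by simp_all

lemma Re_vec_has_derivative:
  assumes "\<forall>k. ((\<lambda>w. \<Psi> w $ k) has_field_derivative c $ k) (at w)"
    and "open D" "w \<in> D" "\<forall>v\<in>D. F v = Re_vec (\<Psi> v)"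
  shows "(F has_derivative (\<lambda>v. Re_vec (v *s c))) (at w)"
proof -
  have "((\<lambda>v. Re_vec (\<Psi> v)) has_derivative (\<lambda>v. Re_vec (v *s c))) (at w)"
    unfolding has_derivative_vec_componentwise
  proof
    fix k
    have "((\<lambda>w. \<Psi> w $ k) has_derivative (\<lambda>v. v * c $ k)) (at w)"
      using assms(1) by (simp add: has_field_derivative_def mult.commute[of _ "c $ k"])
    from has_derivative_Re[OF this]
    show "((\<lambda>v. Re_vec (\<Psi> v) $ k) has_derivative (\<lambda>v. Re_vec (v *s c) $ k)) (at w)"
      by (simp add: Re_vec_def)
  qed
  then show ?thesis
    by (rule has_derivative_transform_within_open[OF _ assms(2,3)]) (use assms(4) in simp)
qed

lemma cvec_has_derivative:
  fixes F :: "complex \<Rightarrow> real^3"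
  assumes "(F has_derivative L) (at w)"
  shows "(cvec \<circ> F has_derivative cvec \<circ> L) (at w)"
  unfolding has_derivative_vec_componentwise
proof
  fix k
  have "((\<lambda>w. F w $ k) has_derivative (\<lambda>v. L v $ k)) (at w)"
    by (rule bounded_linear.has_derivative[OF bounded_linear_vec_nth assms])
  from has_derivative_of_real[OF this]
  show "((\<lambda>w. (cvec \<circ> F) w $ k) has_derivative (\<lambda>v. (cvec \<circ> L) v $ k)) (at w)"
    by (simp add: cvec_def)
qed

lemma d_z_cvec:
  assumes "F differentiable (at w)"
  shows "d_z (cvec \<circ> F) w = (1/2) *s (cvec (pdx F w) - \<i> *s cvec (pdy F w))"
proof -
  obtain L where L: "(F has_derivative L) (at w)" using assms unfolding differentiable_def by blast
  show ?thesis
    unfolding d_z_def using pdx_pdy_eqI[OF L] pdx_pdy_eqI[OF cvec_has_derivative[OF L]] by simp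
qed

context
  fixes F :: "complex \<Rightarrow> real^3" and \<Psi> :: "complex \<Rightarrow> complex^3" and c w D
  assumes \<Psi>: "\<forall>k. ((\<lambda>w. \<Psi> w $ k) has_field_derivative c $ k) (at w)"
    and D: "open D" "w \<in> D" and F: "\<forall>v\<in>D. F v = Re_vec (\<Psi> v)"
begin

lemma Re_vec_differentiable: "F differentiable (at w)"
  using Re_vec_has_derivative[OF \<Psi> D F] differentiable_def by blast

lemma pdx_Re_vec: "pdx F w = Re_vec c"
  and pdy_Re_vec: "pdy F w = Re_vec (\<i> *s c)"
  using pdx_pdy_eqI[OF Re_vec_has_derivative[OF \<Psi> D F]] by simp_all

text \<open>
  For \<open>F = Re \<Psi>\<close> the Cauchy-Riemann equations give \<open>F\<^sub>x - i F\<^sub>y = \<Psi>'\<close>.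
\<close>

lemma cvec_frame_Re_vec: "cvec (pdx F w) - \<i> *s cvec (pdy F w) = c"
  unfolding pdx_Re_vec pdy_Re_vec by (simp add: cvec_def Re_vec_def vec_eq_iff complex_eq_iff)

lemma d_z_Re_vec: "d_z (cvec \<circ> F) w = (1/2) *s c"
  unfolding d_z_cvec[OF Re_vec_differentiable] cvec_frame_Re_vec ..

end

text \<open>
  Both partial derivatives of the real part of a holomorphic curve \<open>\<Psi>\<close> are again such real parts,
  of \<open>\<Psi>'\<close> and \<open>i\<Psi>'\<close>.  The function and the curve are generalised together in the induction.
\<close>

lemma diff_times_Re_vec:
  assumes "open D" "\<forall>k. (\<lambda>w. \<Psi> w $ k) holomorphic_on D" "\<forall>v\<in>D. F v = Re_vec (\<Psi> v)"
  shows "diff_times n D F"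
  using assms(2,3)
proof (induction n arbitrary: F \<Psi>)
  case 0
  have "F differentiable (at w)" if "w \<in> D" for w
    by (rule Re_vec_differentiable[where c = "\<chi> k. deriv (\<lambda>w. \<Psi> w $ k) w" and D = D])
       (use 0 that assms(1) in \<open>auto intro: holomorphic_derivI\<close>)
  then show ?case
    by (simp add: continuous_at_imp_continuous_on differentiable_imp_continuous_within)
next
  case (Suc n)
  let ?d = "\<lambda>w. \<chi> k. deriv (\<lambda>w. \<Psi> w $ k) w"
  have *: "\<forall>k. ((\<lambda>w. \<Psi> w $ k) has_field_derivative ?d w $ k) (at w)" if "w \<in> D" for w
    using Suc.prems that assms(1) by (auto intro: holomorphic_derivI)
  have "diff_times n D (pdx F)"
    by (rule Suc.IH[of ?d])
       (use Suc.prems assms(1) pdx_Re_vec[OF * assms(1)] in \<open>auto intro!: holomorphic_intros\<close>)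
  moreover have "diff_times n D (pdy F)"
    by (rule Suc.IH[of "\<lambda>w. \<i> *s ?d w"])
       (use Suc.prems assms(1) pdy_Re_vec[OF * assms(1)] in \<open>auto intro!: holomorphic_intros\<close>)
  ultimately show ?case
    using Re_vec_differentiable[OF * assms(1)] Suc.prems by simp
qed

lemma smooth_on_Re_vec:
  assumes "open D" "\<forall>k. (\<lambda>w. \<Psi> w $ k) holomorphic_on D" "\<forall>v\<in>D. F v = Re_vec (\<Psi> v)"
  shows "smooth_on D F"
  unfolding smooth_on_def using diff_times_Re_vec[OF assms] by blast

lemma d_zbar_holomorphic:
  assumes "open D" "w \<in> D" "\<forall>k. (\<lambda>w. H w $ k) holomorphic_on D" "\<forall>v\<in>D. G v = H v"
  shows "d_zbar G w = 0"
proof -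
  let ?c = "\<chi> k. deriv (\<lambda>w. H w $ k) w"
  have "(H has_derivative (\<lambda>v. v *s ?c)) (at w)"
    unfolding has_derivative_vec_componentwise
  proof
    fix k
    show "((\<lambda>w. H w $ k) has_derivative (\<lambda>v. (v *s ?c) $ k)) (at w)"
      using holomorphic_derivI[OF assms(3)[rule_format, of k] assms(1,2)]
      by (simp add: has_field_derivative_def mult.commute[of _ "deriv _ _"])
  qed
  then have "(G has_derivative (\<lambda>v. v *s ?c)) (at w)"
    by (rule has_derivative_transform_within_open[OF _ assms(1,2)]) (use assms(4) in simp)
  from pdx_pdy_eqI[OF this] show ?thesis
    unfolding d_zbar_def by (simp add: vec_eq_iff)
qed

text \<open>
  A real derivative \<open>L\<close> with \<open>L 1 + i L i = 0\<close> is multiplication by \<open>L 1\<close>.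
\<close>

lemma field_differentiable_of_d_zbar:
  assumes "G differentiable (at w)" "d_zbar G w = 0"
  shows "(\<lambda>v. G v $ k) field_differentiable (at w)"
proof -
  obtain L where L: "(G has_derivative L) (at w)" using assms(1) unfolding differentiable_def by blast
  have cr: "b = \<i> * a" if "(1/2) * (a + \<i> * b) = 0" for a b :: complex
    using that by (simp add: complex_eq_iff)
  have "((1/2) *s (L 1 + \<i> *s L \<i>)) $ k = 0"
    using assms(2) pdx_pdy_eqI[OF L] unfolding d_zbar_def by simp
  then have i: "L \<i> $ k = \<i> * L 1 $ k"
    unfolding vector_smult_component vector_add_component by (rule cr)
  have lin: "linear L" using has_derivative_linear[OF L] .
  have v: "Re v *\<^sub>R a + Im v *\<^sub>R (\<i> * a) = a * v" for a v :: complex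
    by (simp add: complex_eq_iff algebra_simps)
  have "L v $ k = L 1 $ k * v" for v
    unfolding linear_complex_eq[OF lin, of v] vector_add_component vector_scaleR_component i by (rule v)
  then have *: "(\<lambda>v. L v $ k) = (*) (L 1 $ k)" by (rule ext)
  have "((\<lambda>v. G v $ k) has_field_derivative L 1 $ k) (at w)"
    using L unfolding has_derivative_vec_componentwise has_field_derivative_def *[symmetric] by blast
  then show ?thesis using field_differentiable_def by blast
qed

lemma harmonic_d_z_holomorphic:
  fixes F :: "complex \<Rightarrow> real^3"
  assumes "open D" "smooth_on D F" "\<forall>w\<in>D. d_zbar (d_z (cvec \<circ> F)) w = 0"
  shows "(\<lambda>w. d_z (cvec \<circ> F) w $ k) holomorphic_on D"
  unfolding holomorphic_on_open[OF assms(1)] 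
proof
  fix w assume w: "w \<in> D"
  have d: "diff_times (Suc (Suc 0)) D F" using assms(2) unfolding smooth_on_def by blast
  have "pdx F differentiable (at w)" "pdy F differentiable (at w)" using d w by simp_all
  then obtain L L' where L: "(pdx F has_derivative L) (at w)" and L': "(pdy F has_derivative L') (at w)"
    unfolding differentiable_def by blast
  have comp: "((\<lambda>v. cvec (P v) $ k) has_derivative (\<lambda>v. cvec (M v) $ k)) (at w)"
    if "(P has_derivative M) (at w)" for P M k
    using cvec_has_derivative[OF that] unfolding has_derivative_vec_componentwise by simp
  let ?G = "\<lambda>v. (1/2) *s (cvec (pdx F v) - \<i> *s cvec (pdy F v))"
  have "(?G has_derivative (\<lambda>v. (1/2) *s (cvec (L v) - \<i> *s cvec (L' v)))) (at w)"
    unfolding has_derivative_vec_componentwise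
    by (auto intro!: derivative_eq_intros comp[OF L] comp[OF L'])
  then have "(d_z (cvec \<circ> F) has_derivative (\<lambda>v. (1/2) *s (cvec (L v) - \<i> *s cvec (L' v)))) (at w)"
    by (rule has_derivative_transform_within_open[OF _ assms(1) w]) (use d_z_cvec d in simp)
  then have "d_z (cvec \<circ> F) differentiable (at w)" unfolding differentiable_def by blast
  from field_differentiable_of_d_zbar[OF this] assms(3) w
  show "\<exists>f'. ((\<lambda>w. d_z (cvec \<circ> F) w $ k) has_field_derivative f') (at w)"
    unfolding field_differentiable_def by blast
qed

text \<open>
  If \<open>\<Psi>\<close> is a primitive of \<open>2 F\<^sub>z\<close>, then \<open>Re \<Psi>\<close> has the same derivative as the real map \<open>F\<close>.  The
  difference is a constant vector, which is added to \<open>\<Psi>\<close>.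
\<close>

lemma harmonic_eq_Re_vec_primitive:
  fixes F :: "complex \<Rightarrow> real^3"
  assumes "open D" "convex D" "smooth_on D F" "\<forall>w\<in>D. d_zbar (d_z (cvec \<circ> F)) w = 0"
  obtains \<Psi> :: "complex \<Rightarrow> complex^3" where
    "\<forall>w\<in>D. \<forall>k. ((\<lambda>w. \<Psi> w $ k) has_field_derivative (2 *s d_z (cvec \<circ> F) w) $ k) (at w)"
    "\<forall>w\<in>D. F w = Re_vec (\<Psi> w)"
proof -
  have "\<exists>g. \<forall>x\<in>D. (g has_field_derivative 2 * d_z (cvec \<circ> F) x $ k) (at x)" for k
  proof -
    have "(\<lambda>w. 2 * d_z (cvec \<circ> F) w $ k) holomorphic_on D"
      by (intro holomorphic_intros harmonic_d_z_holomorphic[OF assms(1,3,4)])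
    then obtain g where "\<And>x. x \<in> D \<Longrightarrow> (g has_field_derivative 2 * d_z (cvec \<circ> F) x $ k) (at x within D)"
      using holomorphic_convex_primitive'[OF assms(2,1)] by blast
    then show ?thesis using at_within_open[OF _ assms(1)] by metis
  qed
  then obtain g where g: "\<And>k x. x \<in> D \<Longrightarrow> (g k has_field_derivative 2 * d_z (cvec \<circ> F) x $ k) (at x)"
    by metis
  let ?G = "\<lambda>w. Re_vec (\<chi> k. g k w)"
  have "\<exists>c. \<forall>w\<in>D. F w - ?G w = c"
  proof (rule has_derivative_zero_constant[OF assms(2)])
    fix w assume w: "w \<in> D"
    have "diff_times (Suc 0) D F" using assms(3) unfolding smooth_on_def by blast
    then have Fd: "F differentiable (at w)" using w by simp
    then obtain L where L: "(F has_derivative L) (at w)" unfolding differentiable_def by blast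
    have "(?G has_derivative (\<lambda>v. Re_vec (v *s (2 *s d_z (cvec \<circ> F) w)))) (at w)"
      by (rule Re_vec_has_derivative[OF _ assms(1) w]) (use g w in auto)
    moreover have "Re_vec (v *s (2 *s d_z (cvec \<circ> F) w)) = L v" for v
    proof -
      show ?thesis
        unfolding d_z_cvec[OF Fd] pdx_pdy_eqI[OF L] Re_vec_def cvec_def
          linear_complex_eq[OF has_derivative_linear[OF L], of v]
        by (simp add: vec_eq_iff)
    qed
    ultimately have "(?G has_derivative L) (at w)" by simp
    from has_derivative_diff[OF L this]
    show "((\<lambda>w. F w - ?G w) has_derivative (\<lambda>h. 0)) (at w within D)"
      by (simp add: has_derivative_at_withinI)
  qed
  then obtain c where c: "\<And>w. w \<in> D \<Longrightarrow> F w = ?G w + c" by (metis add.commute diff_add_cancel)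
  show thesis
  proof
    show "\<forall>w\<in>D. \<forall>k. ((\<lambda>w. (\<chi> k. g k w + of_real (c $ k)) $ k) has_field_derivative
        (2 *s d_z (cvec \<circ> F) w) $ k) (at w)"
      using g by (auto intro!: derivative_eq_intros)
    show "\<forall>w\<in>D. F w = Re_vec (\<chi> k. g k w + of_real (c $ k))"
      using c by (simp add: Re_vec_def vec_eq_iff)
  qed
qed

section \<open>Holomorphic maps into the sphere\<close>

lemma north_pole_iff: "v \<in> S2 \<Longrightarrow> v = vector [0, 0, 1] \<longleftrightarrow> v$3 = 1"
  and south_pole_iff: "v \<in> S2 \<Longrightarrow> v = vector [0, 0, -1] \<longleftrightarrow> v$3 = -1"
  unfolding S2_components by (auto simp: vec_eq_iff forall_3)

lemma holomorphic_map_S2_iff: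
  "holomorphic_map M A S2 S2_atlas g \<longleftrightarrow>
     continuous_on M g \<and> g ` M \<subseteq> S2 \<and>
     (\<forall>(U, \<phi>)\<in>A. (stereo \<circ> g \<circ> inv_into U \<phi>) holomorphic_on \<phi> ` (U \<inter> g -` {v\<in>S2. v$3 \<noteq> 1}) \<and>
        (stereo_inf \<circ> g \<circ> inv_into U \<phi>) holomorphic_on \<phi> ` (U \<inter> g -` {v\<in>S2. v$3 \<noteq> -1}))"
proof -
  have "S2 - {vector [0, 0, 1]} = {v\<in>S2. v$3 \<noteq> 1}" "S2 - {vector [0, 0, -1]} = {v\<in>S2. v$3 \<noteq> -1}"
    using north_pole_iff south_pole_iff by blast+
  then show ?thesis
    unfolding holomorphic_map_def S2_atlas_def by (auto simp: split_beta)
qed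

lemma field_differentiable_quotient:
  assumes S: "open S" "w \<in> S" and pq: "p holomorphic_on S" "q holomorphic_on S" "q w \<noteq> 0"
    and F: "\<And>v. v \<in> S \<Longrightarrow> q v \<noteq> 0 \<Longrightarrow> F v = p v / q v"
  shows "F field_differentiable (at w)"
proof -
  let ?N = "S \<inter> q -` (- {0})"
  have N: "open ?N" "w \<in> ?N"
    using continuous_open_preimage[OF holomorphic_on_imp_continuous_on[OF pq(2)] S(1), of "- {0}"] S pq(3)
    by (auto simp: open_Compl)
  have "p field_differentiable (at w)" "q field_differentiable (at w)"
    using S pq holomorphic_on_imp_differentiable_at by blast+
  then obtain d where "((\<lambda>v. p v / q v) has_field_derivative d) (at w)"
    using field_differentiable_divide[of p w UNIV q] pq(3) unfolding field_differentiable_def by blast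
  then have "(F has_field_derivative d) (at w)"
    by (rule has_field_derivative_transform_within_open[OF _ N]) (use F in auto)
  then show ?thesis unfolding field_differentiable_def by blast
qed

text \<open>
  Holomorphy of the \<open>+\<close> transform of the frame \<open>X - iY = c\<close>, in the two affine charts of the sphere.
  Near each point one of the two pairs of homogeneous coordinates of \<open>spinor_of_frame_transform\<close>
  is nonzero, and the chart expression is the quotient of that pair.  The \<open>-\<close> transform is the same
  construction with \<open>-c\<close>.
\<close>

lemma frame_transform_holomorphic:
  assumes W: "open W" and c: "\<forall>k. (\<lambda>w. c w $ k) holomorphic_on W"
    and b: "\<forall>w\<in>W. bilin (c w) (c w) = -4"
  defines "G \<equiv> \<lambda>w. frame_transform (Re_vec (c w)) (Re_vec (\<i> *s c w))"
  shows "continuous_on W G"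
    and "(stereo \<circ> G) holomorphic_on {w\<in>W. G w $ 3 \<noteq> 1}"
    and "(stereo_inf \<circ> G) holomorphic_on {w\<in>W. G w $ 3 \<noteq> -1}"
proof -
  have fr: "adapted_frame (Re_vec (c w)) (Re_vec (\<i> *s c w))" if "w \<in> W" for w
    unfolding adapted_frame_iff_bilin cvec_Re_vec using b that by blast
  have cont: "continuous_on W (\<lambda>w. c w $ k)" for k
    using c holomorphic_on_imp_continuous_on by blast
  have "continuous_on W (\<lambda>w. Re_vec (c w))" "continuous_on W (\<lambda>w. Re_vec (\<i> *s c w))"
    unfolding Re_vec_def by (auto intro!: continuous_intros continuous_on_vec_lambda cont)
  then show G: "continuous_on W G"
    unfolding G_def frame_transform_def
    by (intro continuous_intros continuous_on_cross) (use adapted_frame_pos[OF fr] in fastforce)+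
  then have op: "open {w\<in>W. G w $ 3 \<noteq> e}" for e
  proof -
    have "continuous_on W (\<lambda>w. G w $ 3)" using G by (intro continuous_intros)
    from continuous_open_preimage[OF this W, of "- {e}"] show ?thesis
      by (simp add: vimage_def Int_def open_Compl)
  qed
  define P Q P' Q' where spinors:
    "P = (\<lambda>w. \<i> * c w $ 3 / 2 + 1)" "Q = (\<lambda>w. (\<i> * c w $ 1 + c w $ 2) / 2)"
    "P' = (\<lambda>w. (c w $ 1 + \<i> * c w $ 2) / 2)" "Q' = (\<lambda>w. - c w $ 3 / 2 - \<i>)"
  have hol: "P holomorphic_on W" "Q holomorphic_on W" "P' holomorphic_on W" "Q' holomorphic_on W"
    unfolding spinors using c by (auto intro!: holomorphic_intros)
  have sp: "spinor_of (P w) (Q w) (G w)" "spinor_of (P' w) (Q' w) (G w)" if "w \<in> W" for w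
    using spinor_of_frame_transform[OF fr[OF that]] unfolding cvec_Re_vec spinors G_def
    by (simp_all add: add_divide_distrib)
  \<comment> \<open>This holds because \<open>P - iQ' = i c\<^sub>3 = 2 (P - 1)\<close>.\<close>
  have nz: "P w \<noteq> 0 \<or> Q' w \<noteq> 0" for w
  proof (rule ccontr)
    assume "\<not> ?thesis"
    then have "P w - \<i> * Q' w = 0" by simp
    moreover have "P w - \<i> * Q' w = \<i> * c w $ 3" by (simp add: spinors algebra_simps)
    ultimately have "P w = 1" by (simp add: spinors)
    with \<open>\<not> ?thesis\<close> show False by simp
  qed
  show "(stereo \<circ> G) holomorphic_on {w\<in>W. G w $ 3 \<noteq> 1}" (is "_ holomorphic_on ?S")
    unfolding holomorphic_on_open[OF op] field_differentiable_def[symmetric]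
  proof
    fix w assume w: "w \<in> ?S"
    have fd: "(stereo \<circ> G) field_differentiable (at w)"
      if pq: "p holomorphic_on W" "q holomorphic_on W"
        "\<And>w. w \<in> W \<Longrightarrow> spinor_of (p w) (q w) (G w)" "p w \<noteq> 0 \<or> q w \<noteq> 0" for p q
    proof (rule field_differentiable_quotient[OF op w])
      show "p holomorphic_on ?S" "q holomorphic_on ?S" using pq(1,2) by (auto elim: holomorphic_on_subset)
      show "q w \<noteq> 0" using stereo_of_spinor(1)[OF pq(3) pq(4)] w by simp
      show "(stereo \<circ> G) v = p v / q v" if "v \<in> ?S" "q v \<noteq> 0" for v
        using stereo_of_spinor(2)[OF pq(3)] that by simp
    qed
    show "(stereo \<circ> G) field_differentiable (at w)"
      by (cases "P w = 0") (rule fd[OF hol(3,4) sp(2)] fd[OF hol(1,2) sp(1)]; use nz[of w] in blast)+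
  qed
  show "(stereo_inf \<circ> G) holomorphic_on {w\<in>W. G w $ 3 \<noteq> -1}" (is "_ holomorphic_on ?S")
    unfolding holomorphic_on_open[OF op] field_differentiable_def[symmetric]
  proof
    fix w assume w: "w \<in> ?S"
    have fd: "(stereo_inf \<circ> G) field_differentiable (at w)"
      if pq: "p holomorphic_on W" "q holomorphic_on W"
        "\<And>w. w \<in> W \<Longrightarrow> spinor_of (p w) (q w) (G w)" "p w \<noteq> 0 \<or> q w \<noteq> 0" for p q
    proof (rule field_differentiable_quotient[OF op w])
      show "q holomorphic_on ?S" "p holomorphic_on ?S" using pq(1,2) by (auto elim: holomorphic_on_subset)
      show "p w \<noteq> 0" using stereo_inf_of_spinor(1)[OF pq(3) pq(4)] w by simp
      show "(stereo_inf \<circ> G) v = q v / p v" if "v \<in> ?S" "p v \<noteq> 0" for v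
        using stereo_inf_of_spinor(2)[OF pq(3)] that by simp
    qed
    show "(stereo_inf \<circ> G) field_differentiable (at w)"
      by (cases "P w = 0") (rule fd[OF hol(3,4) sp(2)] fd[OF hol(1,2) sp(1)]; use nz[of w] in blast)+
  qed
qed

section \<open>Charts\<close>

lemma chart_on_inj: "chart_on M U \<phi> \<Longrightarrow> inj_on \<phi> U"
  unfolding chart_on_def homeomorphism_def by (metis inj_onI)

lemma chart_on_homeomorphism:
  assumes "chart_on M U \<phi>"
  shows "homeomorphism U (\<phi> ` U) \<phi> (inv_into U \<phi>)"
proof -
  obtain \<psi> where h: "homeomorphism U (\<phi> ` U) \<phi> \<psi>" using assms unfolding chart_on_def by blast
  show ?thesis
    by (rule homeomorphism_cong[OF h])
       (use h chart_on_inj[OF assms] in \<open>auto simp: homeomorphism_def\<close>)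
qed

lemma chart_on_image_open:
  assumes "chart_on M U \<phi>" "openin (top_of_set M) V"
  shows "open (\<phi> ` (U \<inter> V))"
proof -
  have "openin (top_of_set U) (U \<inter> V)"
    using assms openin_Int[OF _ assms(2)] unfolding chart_on_def
    by (metis inf_le1 openin_subset_trans openin_imp_subset)
  then have "openin (top_of_set (\<phi> ` U)) (\<phi> ` (U \<inter> V))"
    using homeomorphism_imp_open_map[OF chart_on_homeomorphism[OF assms(1)]] by blast
  then show ?thesis
    using assms(1) openin_open_trans unfolding chart_on_def by blast
qed

text \<open>
  The chain rule for the identity, written as a coordinate change followed by its inverse.
\<close>

lemma transition_derivative:
  assumes U: "chart_on M U \<phi>" and V: "chart_on M V \<psi>" and c: "compatible (U, \<phi>) (V, \<psi>)"
    and w: "w \<in> \<phi> ` (U \<inter> V)"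
  obtains d where "d \<noteq> 0" "((\<psi> \<circ> inv_into U \<phi>) has_field_derivative d) (at w)"
proof -
  have UV: "openin (top_of_set M) U" "openin (top_of_set M) V" using U V unfolding chart_on_def by auto
  have o: "open (\<phi> ` (U \<inter> V))" "open (\<psi> ` (U \<inter> V))"
    using chart_on_image_open[OF U UV(2)] chart_on_image_open[OF V UV(1)] by (simp_all add: Int_commute)
  obtain x where x: "x \<in> U" "x \<in> V" "w = \<phi> x" using w by blast
  have inv: "inv_into U \<phi> (\<phi> y) = y" if "y \<in> U" for y using chart_on_inj[OF U] that by simp
  have inv': "inv_into V \<psi> (\<psi> y) = y" if "y \<in> V" for y using chart_on_inj[OF V] that by simp
  have "(\<psi> \<circ> inv_into U \<phi>) field_differentiable (at w)"
    using c o(1) w holomorphic_on_imp_differentiable_at unfolding compatible_def by blast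
  then obtain d where d: "((\<psi> \<circ> inv_into U \<phi>) has_field_derivative d) (at w)"
    unfolding field_differentiable_def by blast
  have "\<psi> x \<in> \<psi> ` (U \<inter> V)" using x by blast
  then have "(\<phi> \<circ> inv_into V \<psi>) field_differentiable (at (\<psi> x))"
    using c o(2) holomorphic_on_imp_differentiable_at unfolding compatible_def by blast
  then obtain e where "((\<phi> \<circ> inv_into V \<psi>) has_field_derivative e) (at (\<psi> x))"
    unfolding field_differentiable_def by blast
  moreover have "\<psi> x = (\<psi> \<circ> inv_into U \<phi>) w" using x inv by simp
  ultimately have "((\<phi> \<circ> inv_into V \<psi>) \<circ> (\<psi> \<circ> inv_into U \<phi>) has_field_derivative e * d) (at w)"
    by (intro DERIV_chain d) simp
  then have "((\<lambda>v. v) has_field_derivative e * d) (at w)"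
    by (rule has_field_derivative_transform_within_open[OF _ o(1) w]) (auto simp: inv inv')
  then have "e * d = 1" using DERIV_unique DERIV_ident by blast
  then have "d \<noteq> 0" by auto
  then show thesis using d that by blast
qed

text \<open>
  Near a point whose image is not the north pole, \<open>(stereo \<circ> g : 1)\<close> are holomorphic homogeneous
  coordinates of \<open>g\<close>; otherwise the image is not the south pole and \<open>(1 : stereo_inf \<circ> g)\<close> are.  The
  atlas describes \<open>g\<close> in its own charts only, so a coordinate change leads to the given coordinate.
\<close>

lemma holomorphic_map_spinors:
  assumes M: "riemann_surface M A" and z: "complex_coordinate M A M z"
    and g: "holomorphic_map M A S2 S2_atlas g" and w: "w \<in> z ` M"
  obtains N p q where "open N" "w \<in> N" "N \<subseteq> z ` M" "p holomorphic_on N" "q holomorphic_on N"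
    "\<And>v. v \<in> N \<Longrightarrow> spinor_of (p v) (q v) (in_coord g M z v) \<and> (p v \<noteq> 0 \<or> q v \<noteq> 0)"
proof -
  have zc: "chart_on M M z" and comp: "\<And>c. c \<in> A \<Longrightarrow> compatible (M, z) c"
    using z unfolding complex_coordinate_def by auto
  have inv: "inv_into M z (z y) = y" if "y \<in> M" for y using chart_on_inj[OF zc] that by simp
  obtain x where x: "x \<in> M" "w = z x" using w by blast
  obtain U \<phi> where U: "(U, \<phi>) \<in> A" "x \<in> U" using M x(1) unfolding riemann_surface_def by blast
  then have Uc: "chart_on M U \<phi>" using M unfolding riemann_surface_def by blast
  then have UM: "openin (top_of_set M) U" "U \<subseteq> M"
    unfolding chart_on_def using openin_imp_subset by auto
  have invU: "inv_into U \<phi> (\<phi> y) = y" if "y \<in> U" for y using chart_on_inj[OF Uc] that by simp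
  note gg = g[unfolded holomorphic_map_S2_iff]
  have gc: "continuous_on M g" "\<And>y. y \<in> M \<Longrightarrow> g y \<in> S2" using gg by auto
  have gh: "(stereo \<circ> g \<circ> inv_into U \<phi>) holomorphic_on \<phi> ` (U \<inter> g -` {v\<in>S2. v$3 \<noteq> 1})"
      "(stereo_inf \<circ> g \<circ> inv_into U \<phi>) holomorphic_on \<phi> ` (U \<inter> g -` {v\<in>S2. v$3 \<noteq> -1})"
    using gg U(1) by blast+
  have tr: "(\<phi> \<circ> inv_into M z) holomorphic_on z ` (M \<inter> U)"
    using comp[OF U(1)] unfolding compatible_def by simp
  \<comment> \<open>The parameter \<open>e\<close> is the third component of the pole to be avoided.\<close>
  define N where "N = (\<lambda>e. z ` (M \<inter> (U \<inter> (M \<inter> g -` (- {v. v $ 3 = e})))))"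
  have "open (- {v::real^3. v $ 3 = e})" for e
    by (intro open_Compl closed_Collect_eq continuous_intros)
  then have oN: "open (N e)" for e
    unfolding N_def
    by (rule chart_on_image_open[OF zc openin_Int[OF UM(1) continuous_openin_preimage_gen[OF gc(1)]]])
  have sub: "N e \<subseteq> z ` M" "N e \<subseteq> z ` (M \<inter> U)" for e unfolding N_def by auto
  have im: "(\<phi> \<circ> inv_into M z) ` N e \<subseteq> \<phi> ` (U \<inter> g -` {v\<in>S2. v$3 \<noteq> e})" for e
    unfolding N_def using inv gc(2) by auto
  have S2: "in_coord g M z v \<in> S2" "in_coord g M z v $ 3 \<noteq> e" if "v \<in> N e" for e v
    using that gc(2) unfolding in_coord_def N_def by (auto simp: inv)
  consider "g x $ 3 \<noteq> 1" | "g x $ 3 \<noteq> -1" by force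
  then show thesis
  proof cases
    case 1
    have "((stereo \<circ> g \<circ> inv_into U \<phi>) \<circ> (\<phi> \<circ> inv_into M z)) holomorphic_on N 1"
      by (rule holomorphic_on_compose_gen[OF holomorphic_on_subset[OF tr sub(2)] gh(1) im])
    then have "(\<lambda>v. stereo (in_coord g M z v)) holomorphic_on N 1"
      by (rule holomorphic_transform) (auto simp: in_coord_def N_def inv invU)
    moreover have "w \<in> N 1" using 1 x U unfolding N_def by auto
    ultimately show thesis
      using that[of "N 1" "\<lambda>v. stereo (in_coord g M z v)" "\<lambda>_. 1"] oN sub spinor_of_stereo S2 by auto
  next
    case 2
    have "((stereo_inf \<circ> g \<circ> inv_into U \<phi>) \<circ> (\<phi> \<circ> inv_into M z)) holomorphic_on N (-1)"
      by (rule holomorphic_on_compose_gen[OF holomorphic_on_subset[OF tr sub(2)] gh(2) im])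
    then have "(\<lambda>v. stereo_inf (in_coord g M z v)) holomorphic_on N (-1)"
      by (rule holomorphic_transform) (auto simp: in_coord_def N_def inv invU)
    moreover have "w \<in> N (-1)" using 2 x U unfolding N_def by auto
    ultimately show thesis
      using that[of "N (-1)" "\<lambda>_. 1" "\<lambda>v. stereo_inf (in_coord g M z v)"] oN sub spinor_of_stereo_inf S2
      by auto
  qed
qed

lemma integrand_holomorphic:
  assumes M: "riemann_surface M A" and z: "complex_coordinate M A M z"
    and g: "holomorphic_map M A S2 S2_atlas g" and h: "holomorphic_map M A S2 S2_atlas h"
    and gh: "\<forall>p\<in>M. g p - h p \<noteq> 0 \<and> g p + h p \<noteq> 0"
  shows "(\<lambda>w. integrand (in_coord g M z w) (in_coord h M z w) $ k) holomorphic_on z ` M"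
proof -
  have zM: "open (z ` M)" using z unfolding complex_coordinate_def chart_on_def by auto
  show ?thesis
    unfolding holomorphic_on_open[OF zM] field_differentiable_def[symmetric]
  proof
    fix w assume w: "w \<in> z ` M"
    obtain N p0 p1 where N: "open N" "w \<in> N" "N \<subseteq> z ` M" "p0 holomorphic_on N" "p1 holomorphic_on N"
      "\<And>v. v \<in> N \<Longrightarrow> spinor_of (p0 v) (p1 v) (in_coord g M z v) \<and> (p0 v \<noteq> 0 \<or> p1 v \<noteq> 0)"
      using holomorphic_map_spinors[OF M z g w] by blast
    obtain N' q0 q1 where N': "open N'" "w \<in> N'" "N' \<subseteq> z ` M" "q0 holomorphic_on N'" "q1 holomorphic_on N'"
      "\<And>v. v \<in> N' \<Longrightarrow> spinor_of (q0 v) (q1 v) (in_coord h M z v) \<and> (q0 v \<noteq> 0 \<or> q1 v \<noteq> 0)"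
      using holomorphic_map_spinors[OF M z h w] by blast
    let ?S = "N \<inter> N'"
    have S: "open ?S" "w \<in> ?S" using N N' by auto
    have hol: "p0 holomorphic_on ?S" "p1 holomorphic_on ?S" "q0 holomorphic_on ?S" "q1 holomorphic_on ?S"
      using N(4,5) N'(4,5) by (auto elim: holomorphic_on_subset)
    have I: "p0 v * q1 v - q0 v * p1 v \<noteq> 0"
      "integrand (in_coord g M z v) (in_coord h M z v) $ 1
        = \<i> * (p0 v * q0 v - p1 v * q1 v) / (2 * (p0 v * q1 v - q0 v * p1 v))"
      "integrand (in_coord g M z v) (in_coord h M z v) $ 2
        = (p0 v * q0 v + p1 v * q1 v) / (2 * (p0 v * q1 v - q0 v * p1 v))"
      "integrand (in_coord g M z v) (in_coord h M z v) $ 3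
        = - \<i> * (p0 v * q1 v + p1 v * q0 v) / (2 * (p0 v * q1 v - q0 v * p1 v))"
      if v: "v \<in> ?S" for v
    proof -
      have "v \<in> z ` M" using v N(3) by blast
      then have "inv_into M z v \<in> M" by (rule inv_into_into)
      then have *: "in_coord g M z v \<in> S2" "in_coord h M z v \<in> S2"
        "in_coord g M z v - in_coord h M z v \<noteq> 0" "in_coord g M z v + in_coord h M z v \<noteq> 0"
        using g h gh unfolding holomorphic_map_def in_coord_def by auto
      have **: "spinor_of (p0 v) (p1 v) (in_coord g M z v)" "p0 v \<noteq> 0 \<or> p1 v \<noteq> 0"
         "spinor_of (q0 v) (q1 v) (in_coord h M z v)" "q0 v \<noteq> 0 \<or> q1 v \<noteq> 0"
        using N(6) N'(6) v by blast+
      note I = integrand_of_spinors[OF * **]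
      show "p0 v * q1 v - q0 v * p1 v \<noteq> 0"
        "integrand (in_coord g M z v) (in_coord h M z v) $ 1
          = \<i> * (p0 v * q0 v - p1 v * q1 v) / (2 * (p0 v * q1 v - q0 v * p1 v))"
        "integrand (in_coord g M z v) (in_coord h M z v) $ 2
          = (p0 v * q0 v + p1 v * q1 v) / (2 * (p0 v * q1 v - q0 v * p1 v))"
        "integrand (in_coord g M z v) (in_coord h M z v) $ 3
          = - \<i> * (p0 v * q1 v + p1 v * q0 v) / (2 * (p0 v * q1 v - q0 v * p1 v))"
        by (fact I)+
    qed
    have "k = 1 \<or> k = 2 \<or> k = 3" by (rule exhaust_3)
    then have "(\<lambda>w. integrand (in_coord g M z w) (in_coord h M z w) $ k) holomorphic_on ?S"
    proof (elim disjE)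
      assume k: "k = 1"
      have "(\<lambda>v. \<i> * (p0 v * q0 v - p1 v * q1 v) / (2 * (p0 v * q1 v - q0 v * p1 v))) holomorphic_on ?S"
        by (intro holomorphic_intros hol) (use I(1) in simp)
      then show ?thesis by (rule holomorphic_transform) (use I(2) k in simp)
    next
      assume k: "k = 2"
      have "(\<lambda>v. (p0 v * q0 v + p1 v * q1 v) / (2 * (p0 v * q1 v - q0 v * p1 v))) holomorphic_on ?S"
        by (intro holomorphic_intros hol) (use I(1) in simp)
      then show ?thesis by (rule holomorphic_transform) (use I(3) k in simp)
    next
      assume k: "k = 3"
      have "(\<lambda>v. - \<i> * (p0 v * q1 v + p1 v * q0 v) / (2 * (p0 v * q1 v - q0 v * p1 v))) holomorphic_on ?S"
        by (intro holomorphic_intros hol) (use I(1) in simp)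
      then show ?thesis by (rule holomorphic_transform) (use I(4) k in simp)
    qed
    then show "(\<lambda>w. integrand (in_coord g M z w) (in_coord h M z w) $ k) field_differentiable (at w)"
      using S holomorphic_on_imp_differentiable_at by blast
  qed
qed

section \<open>The surface given by two holomorphic maps\<close>

lemma exists_representation:
  assumes M: "riemann_surface M A" "simply_connected M" and z: "complex_coordinate M A M z"
    and g: "holomorphic_map M A S2 S2_atlas g" and h: "holomorphic_map M A S2 S2_atlas h"
    and gh: "\<forall>p\<in>M. g p - h p \<noteq> 0 \<and> g p + h p \<noteq> 0"
  shows "\<exists>f. given_by_formula M z g h f"
proof -
  have zc: "chart_on M M z" using z unfolding complex_coordinate_def by simp
  have "M homeomorphic z ` M" using chart_on_homeomorphism[OF zc] homeomorphic_def by blast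
  then have sc: "simply_connected (z ` M)" using M(2) homeomorphic_simply_connected by blast
  have "open (z ` M)" using zc unfolding chart_on_def by simp
  from simply_connected_eq_global_primitive[OF this] sc
  have "\<exists>P. \<forall>w\<in>z ` M. (P has_field_derivative
      integrand (in_coord g M z w) (in_coord h M z w) $ k) (at w)" for k
    using integrand_holomorphic[OF M(1) z g h gh, of k] by blast
  then obtain P where P: "\<And>k w. w \<in> z ` M \<Longrightarrow> (P k has_field_derivative
      integrand (in_coord g M z w) (in_coord h M z w) $ k) (at w)" by metis
  have "given_by_formula M z g h (\<lambda>p. 4 *\<^sub>R Re_vec (\<chi> k. P k (z p)))"
    unfolding given_by_formula_def
    by (rule exI[of _ "\<lambda>w. \<chi> k. P k w"]) (use P in simp)
  then show ?thesis by blast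
qed

text \<open>
  The derivative of the holomorphic curve \<open>\<Psi> = 4\<Phi>\<close>, whose real part is \<open>f\<close>, is the vector \<open>X - iY\<close>
  determined by \<open>g\<close> and \<open>h\<close>; this settles the statements about the coordinate \<open>z\<close>.  In a chart of
  the atlas the curve is composed with a coordinate change, which multiplies \<open>f\<^sub>z\<close> by a nonzero number
  \<open>t\<close> and \<open>\<langle>f\<^sub>z, f\<^sub>z\<rangle>\<close> by \<open>t\<^sup>2\<close>.
\<close>

lemma representation_surface:
  assumes M: "riemann_surface M A" and z: "complex_coordinate M A M z"
    and g: "\<forall>p\<in>M. g p \<in> S2" and h: "\<forall>p\<in>M. h p \<in> S2"
    and gh: "\<forall>p\<in>M. g p - h p \<noteq> 0 \<and> g p + h p \<noteq> 0"
    and f: "given_by_formula M z g h f"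
  shows "nonconformal_harmonic_surface M A f" and "adapted M z f"
    and "p \<in> M \<Longrightarrow> transform 1 M z f p = g p" and "p \<in> M \<Longrightarrow> transform (-1) M z f p = h p"
proof -
  have zc: "chart_on M M z" and comp: "\<And>c. c \<in> A \<Longrightarrow> compatible (M, z) c"
    using z unfolding complex_coordinate_def by auto
  have D: "open (z ` M)" using zc unfolding chart_on_def by simp
  have inv: "inv_into M z (z y) = y" if "y \<in> M" for y using chart_on_inj[OF zc] that by simp
  obtain \<Phi> where \<Phi>: "\<And>w k. w \<in> z ` M \<Longrightarrow> ((\<lambda>w. \<Phi> w $ k) has_field_derivative
           integrand (in_coord g M z w) (in_coord h M z w) $ k) (at w)"
    and f\<Phi>: "\<And>p. p \<in> M \<Longrightarrow> f p = 4 *\<^sub>R Re_vec (\<Phi> (z p))"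
    using f unfolding given_by_formula_def by blast
  define d where "d = (\<lambda>p. (g p - h p) \<bullet> (g p - h p))"
  define X Y where "X = (\<lambda>p. (4 / d p) *\<^sub>R cross3 (g p) (h p))" and "Y = (\<lambda>p. (4 / d p) *\<^sub>R (g p - h p))"
  define c where "c = (\<lambda>p. cvec (X p) - \<i> *s cvec (Y p))"
  have fr: "adapted_frame (X p) (Y p)" "X p \<noteq> 0" "frame_transform (X p) (Y p) = g p"
    "frame_transform (- X p) (- Y p) = h p" "integrand (g p) (h p) = (1/4) *s c p" if "p \<in> M" for p
    using frame_of_sphere_pair[of "g p" "h p"] that g h gh
    unfolding c_def X_def Y_def d_def by simp_all
  define \<Psi> where "\<Psi> = (\<lambda>w. 4 *s \<Phi> w)"
  have \<Psi>: "((\<lambda>w. \<Psi> w $ k) has_field_derivative c p $ k) (at (z p))" if "p \<in> M" for p k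
    using DERIV_cmult[OF \<Phi>[of "z p" k], of 4] that fr(5)[OF that]
    by (simp add: \<Psi>_def in_coord_def inv)
  have f\<Psi>: "f p = Re_vec (\<Psi> (z p))" if "p \<in> M" for p
    using f\<Phi>[OF that] by (simp add: \<Psi>_def Re_vec_def vec_eq_iff)
  have cc: "bilin (c p) (c p) = -4" if "p \<in> M" for p
    using fr(1)[OF that] unfolding adapted_frame_iff_bilin c_def .
  have F: "\<forall>v\<in>z ` M. in_coord f M z v = Re_vec (\<Psi> v)"
    using f\<Psi> by (auto simp: in_coord_def inv)
  have pd: "pdx (in_coord f M z) (z p) = X p" "pdy (in_coord f M z) (z p) = Y p"
    "d_z (cvec \<circ> in_coord f M z) (z p) = (1/2) *s c p" if p: "p \<in> M" for p
  proof -
    have *: "\<forall>k. ((\<lambda>w. \<Psi> w $ k) has_field_derivative c p $ k) (at (z p))" "z p \<in> z ` M"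
      using \<Psi> p by auto
    show "pdx (in_coord f M z) (z p) = X p" "pdy (in_coord f M z) (z p) = Y p"
      unfolding pdx_Re_vec[OF *(1) D *(2) F] pdy_Re_vec[OF *(1) D *(2) F] c_def
      by (simp_all add: Re_vec_def cvec_def vec_eq_iff)
    show "d_z (cvec \<circ> in_coord f M z) (z p) = (1/2) *s c p"
      by (rule d_z_Re_vec[OF *(1) D *(2) F])
  qed
  show "adapted M z f"
    unfolding adapted_def by (auto simp: pd bilin_scale cc)
  show "p \<in> M \<Longrightarrow> transform 1 M z f p = g p" "p \<in> M \<Longrightarrow> transform (-1) M z f p = h p"
    using transform_eq_frame_transform[OF fr(1,2) pd(1,2)[symmetric]] fr(3,4) by simp_all
  have chart: "smooth_on (\<phi> ` U) (in_coord f U \<phi>) \<and>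
      (\<forall>w\<in>\<phi> ` U. inj (frechet_derivative (in_coord f U \<phi>) (at w)) \<and>
          d_zbar (d_z (cvec \<circ> in_coord f U \<phi>)) w = 0 \<and>
          bilin (d_z (cvec \<circ> in_coord f U \<phi>) w) (d_z (cvec \<circ> in_coord f U \<phi>) w) \<noteq> 0)"
    if U: "(U, \<phi>) \<in> A" for U \<phi>
  proof -
    have Uc: "chart_on M U \<phi>" using M U unfolding riemann_surface_def by blast
    have UM: "U \<subseteq> M" and E: "open (\<phi> ` U)" using Uc openin_imp_subset unfolding chart_on_def by blast+
    have invU: "inv_into U \<phi> (\<phi> y) = y" if "y \<in> U" for y using chart_on_inj[OF Uc] that by simp
    define \<tau> where "\<tau> = z \<circ> inv_into U \<phi>"
    define H where "H = (\<lambda>w. \<Psi> (\<tau> w))"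
    have FH: "\<forall>v\<in>\<phi> ` U. in_coord f U \<phi> v = Re_vec (H v)"
      using f\<Psi> UM by (auto simp: in_coord_def invU H_def \<tau>_def)
    have "compatible (U, \<phi>) (M, z)" using comp[OF U] unfolding compatible_def by auto
    then have tr: "\<exists>t. t \<noteq> 0 \<and> (\<tau> has_field_derivative t) (at w)" if "w \<in> \<phi> ` U" for w
      using transition_derivative[OF Uc zc, of w] that UM unfolding \<tau>_def by (metis inf.absorb1)
    have H: "\<exists>t. t \<noteq> 0 \<and> (\<forall>k. ((\<lambda>w. H w $ k) has_field_derivative (t *s c x) $ k) (at (\<phi> x)))"
      if x: "x \<in> U" for x
    proof -
      obtain t where t: "t \<noteq> 0" "(\<tau> has_field_derivative t) (at (\<phi> x))" using tr x by blast
      have "((\<lambda>w. H w $ k) has_field_derivative (t *s c x) $ k) (at (\<phi> x))" for k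
      proof -
        have "\<tau> (\<phi> x) = z x" using x by (simp add: \<tau>_def invU)
        then have "((\<lambda>w. \<Psi> w $ k) has_field_derivative c x $ k) (at (\<tau> (\<phi> x)))"
          using \<Psi> x UM by auto
        from DERIV_chain2[OF this t(2)] show ?thesis by (simp add: H_def mult.commute)
      qed
      then show ?thesis using t(1) by blast
    qed
    have hol: "\<forall>k. (\<lambda>w. H w $ k) holomorphic_on \<phi> ` U"
      unfolding holomorphic_on_open[OF E] using H by blast
    have "smooth_on (\<phi> ` U) (in_coord f U \<phi>)" by (rule smooth_on_Re_vec[OF E hol FH])
    moreover have "inj (frechet_derivative (in_coord f U \<phi>) (at (\<phi> x)))"
      "bilin (d_z (cvec \<circ> in_coord f U \<phi>) (\<phi> x)) (d_z (cvec \<circ> in_coord f U \<phi>) (\<phi> x)) \<noteq> 0"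
      if x: "x \<in> U" for x
    proof -
      obtain t where t: "t \<noteq> 0"
        and Ht: "\<forall>k. ((\<lambda>w. H w $ k) has_field_derivative (t *s c x) $ k) (at (\<phi> x))"
        using H[OF x] by blast
      have xU: "\<phi> x \<in> \<phi> ` U" "x \<in> M" using x UM by auto
      have "frechet_derivative (in_coord f U \<phi>) (at (\<phi> x)) = (\<lambda>v. Re_vec (v *s (t *s c x)))"
        by (rule frechet_derivative_at[OF Re_vec_has_derivative[OF Ht E xU(1) FH], symmetric])
      then show "inj (frechet_derivative (in_coord f U \<phi>) (at (\<phi> x)))"
        using inj_frame[OF fr(1,2) t] xU(2) unfolding c_def by simp
      show "bilin (d_z (cvec \<circ> in_coord f U \<phi>) (\<phi> x)) (d_z (cvec \<circ> in_coord f U \<phi>) (\<phi> x)) \<noteq> 0"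
        unfolding d_z_Re_vec[OF Ht E xU(1) FH] bilin_scale cc[OF xU(2)] using t by simp
    qed
    moreover have "d_zbar (d_z (cvec \<circ> in_coord f U \<phi>)) w = 0" if w: "w \<in> \<phi> ` U" for w
    proof (rule d_zbar_holomorphic[OF E w])
      let ?G = "\<lambda>w. (1/2) *s (\<chi> k. deriv (\<lambda>w. H w $ k) w)"
      show "\<forall>k. (\<lambda>w. ?G w $ k) holomorphic_on \<phi> ` U"
        using hol E by (auto intro!: holomorphic_intros)
      show "\<forall>v\<in>\<phi> ` U. d_z (cvec \<circ> in_coord f U \<phi>) v = ?G v"
      proof
        fix v assume v: "v \<in> \<phi> ` U"
        have "\<forall>k. ((\<lambda>w. H w $ k) has_field_derivative (\<chi> k. deriv (\<lambda>w. H w $ k) v) $ k) (at v)"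
          using holomorphic_derivI[OF _ E v] hol by simp
        then show "d_z (cvec \<circ> in_coord f U \<phi>) v = ?G v" by (rule d_z_Re_vec[OF _ E v FH])
      qed
    qed
    ultimately show ?thesis by blast
  qed
  show "nonconformal_harmonic_surface M A f"
    unfolding nonconformal_harmonic_surface_def harmonic_immersion_def Let_def
    using chart by fast
qed

section \<open>Local representation of a given surface\<close>

lemma reparametrised_chart:
  assumes M: "riemann_surface M A" and U: "(U, \<phi>) \<in> A"
    and W: "open W" "W \<subseteq> \<phi> ` U" and \<zeta>: "\<zeta> holomorphic_on W" "inj_on \<zeta> W"
  defines "V \<equiv> U \<inter> \<phi> -` W"
  shows "openin (top_of_set M) V" and "complex_coordinate M A V (\<zeta> \<circ> \<phi>)" and "V homeomorphic W"
proof -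
  have Uc: "chart_on M U \<phi>" and charts: "\<And>V' \<psi>. (V', \<psi>) \<in> A \<Longrightarrow> chart_on M V' \<psi>"
    and comp: "\<And>c d. c \<in> A \<Longrightarrow> d \<in> A \<Longrightarrow> compatible c d"
    using M U unfolding riemann_surface_def by blast+
  have inv: "inv_into U \<phi> (\<phi> y) = y" if "y \<in> U" for y using chart_on_inj[OF Uc] that by simp
  have hU: "homeomorphism U (\<phi> ` U) \<phi> (inv_into U \<phi>)" by (rule chart_on_homeomorphism[OF Uc])
  have im: "\<phi> ` V = W" using W(2) unfolding V_def by auto
  have hV: "homeomorphism V W \<phi> (inv_into U \<phi>)"
    by (rule homeomorphism_of_subsets[OF hU _ W(2) im]) (auto simp: V_def)
  then show "V homeomorphic W" unfolding homeomorphic_def by blast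
  have "continuous_on U \<phi>" using hU unfolding homeomorphism_def by blast
  from continuous_openin_preimage_gen[OF this W(1)] Uc
  show VM: "openin (top_of_set M) V" unfolding V_def chart_on_def using openin_trans by blast
  obtain \<zeta>' where \<zeta>': "\<zeta>' holomorphic_on \<zeta> ` W" "\<And>w. w \<in> W \<Longrightarrow> \<zeta>' (\<zeta> w) = w"
    using holomorphic_has_inverse[OF \<zeta>(1) W(1) \<zeta>(2)] by metis
  have "homeomorphism W (\<zeta> ` W) \<zeta> \<zeta>'"
    using \<zeta>(1) \<zeta>' by (intro homeomorphismI holomorphic_on_imp_continuous_on) auto
  from homeomorphism_compose[OF hV this]
  have hz: "homeomorphism V ((\<zeta> \<circ> \<phi>) ` V) (\<zeta> \<circ> \<phi>) (inv_into U \<phi> \<circ> \<zeta>')"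
    unfolding image_comp[symmetric] im .
  have "open (\<zeta> ` W)" by (rule open_mapping_thm3[OF \<zeta>(1) W(1) \<zeta>(2)])
  then have Vc: "chart_on M V (\<zeta> \<circ> \<phi>)"
    using hz VM im unfolding chart_on_def image_comp[symmetric] by metis
  have "compatible (V, \<zeta> \<circ> \<phi>) (V', \<psi>)" if V': "(V', \<psi>) \<in> A" for V' \<psi>
  proof -
    have "compatible (U, \<phi>) (V', \<psi>)" using comp U V' by blast
    then have c: "(\<psi> \<circ> inv_into U \<phi>) holomorphic_on \<phi> ` (U \<inter> V')"
       "(\<phi> \<circ> inv_into V' \<psi>) holomorphic_on \<psi> ` (U \<inter> V')" unfolding compatible_def by auto
    have inv': "inv_into V' \<psi> (\<psi> y) = y" if "y \<in> V'" for y
      using chart_on_inj[OF charts[OF V']] that by simp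
    have invz: "inv_into V (\<zeta> \<circ> \<phi>) (\<zeta> (\<phi> y)) = y" if "y \<in> V" for y
      using inv_into_f_f[OF chart_on_inj[OF Vc] that] by simp
    have VU: "y \<in> U" if "y \<in> V" for y using that unfolding V_def by simp
    have \<zeta>'\<phi>: "\<zeta>' (\<zeta> (\<phi> y)) = \<phi> y" if "y \<in> V" for y using \<zeta>'(2) that unfolding V_def by auto
    have "((\<psi> \<circ> inv_into U \<phi>) \<circ> \<zeta>') holomorphic_on (\<zeta> \<circ> \<phi>) ` (V \<inter> V')"
    proof (rule holomorphic_on_compose_gen[OF _ c(1)])
      show "\<zeta>' holomorphic_on (\<zeta> \<circ> \<phi>) ` (V \<inter> V')"
        by (rule holomorphic_on_subset[OF \<zeta>'(1)]) (auto simp: V_def)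
      show "\<zeta>' ` (\<zeta> \<circ> \<phi>) ` (V \<inter> V') \<subseteq> \<phi> ` (U \<inter> V')"
        using \<zeta>'\<phi> by (auto simp: V_def)
    qed
    then have "(\<psi> \<circ> inv_into V (\<zeta> \<circ> \<phi>)) holomorphic_on (\<zeta> \<circ> \<phi>) ` (V \<inter> V')"
      by (rule holomorphic_transform) (auto simp: \<zeta>'\<phi> invz inv VU)
    moreover have "(\<zeta> \<circ> (\<phi> \<circ> inv_into V' \<psi>)) holomorphic_on \<psi> ` (V \<inter> V')"
    proof (rule holomorphic_on_compose_gen[OF _ \<zeta>(1)])
      show "(\<phi> \<circ> inv_into V' \<psi>) holomorphic_on \<psi> ` (V \<inter> V')"
        by (rule holomorphic_on_subset[OF c(2)]) (auto simp: V_def)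
      show "(\<phi> \<circ> inv_into V' \<psi>) ` \<psi> ` (V \<inter> V') \<subseteq> W" by (auto simp: V_def inv')
    qed
    ultimately show ?thesis unfolding compatible_def by (simp add: comp_assoc)
  qed
  then show "complex_coordinate M A V (\<zeta> \<circ> \<phi>)"
    using Vc unfolding complex_coordinate_def by auto
qed

text \<open>
  Under the coordinate change \<open>\<zeta>\<close> the derivative \<open>\<phi> = f\<^sub>z\<close> becomes \<open>\<phi>/\<zeta>'\<close>, so \<open>\<zeta>'\<^sup>2 = -\<langle>\<phi>, \<phi>\<rangle>\<close> is the
  condition for \<open>\<zeta>\<close> to be adapted.
\<close>

lemma adapted_reparametrisation:
  assumes D: "open D" "w0 \<in> D"
    and \<phi>: "\<And>k. (\<lambda>w. \<phi> w $ k) holomorphic_on D" "\<And>w. w \<in> D \<Longrightarrow> bilin (\<phi> w) (\<phi> w) \<noteq> 0"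
  obtains r s \<zeta> where "r > 0" "ball w0 r \<subseteq> D" "s holomorphic_on ball w0 r"
    "\<And>w. w \<in> ball w0 r \<Longrightarrow> s w \<noteq> 0 \<and> (s w)\<^sup>2 = - bilin (\<phi> w) (\<phi> w)"
    "\<And>w. w \<in> ball w0 r \<Longrightarrow> (\<zeta> has_field_derivative s w) (at w)" "inj_on \<zeta> (ball w0 r)"
proof -
  obtain R where R: "R > 0" "ball w0 R \<subseteq> D" using D openE by blast
  have hol: "(\<lambda>w. - bilin (\<phi> w) (\<phi> w)) holomorphic_on ball w0 R"
    unfolding bilin_def by (intro holomorphic_intros holomorphic_on_subset[OF \<phi>(1) R(2)])
  have nz: "- bilin (\<phi> w) (\<phi> w) \<noteq> 0" if "w \<in> ball w0 R" for w
    using \<phi>(2)[of w] that R(2) by auto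
  have "\<exists>s. s holomorphic_on ball w0 R \<and> (\<forall>w\<in>ball w0 R. - bilin (\<phi> w) (\<phi> w) = (s w)\<^sup>2)"
    by (rule contractible_imp_holomorphic_sqrt[OF hol convex_imp_contractible[OF convex_ball] nz]) auto
  then obtain s where s: "s holomorphic_on ball w0 R"
    and s2: "\<And>w. w \<in> ball w0 R \<Longrightarrow> - bilin (\<phi> w) (\<phi> w) = (s w)\<^sup>2"
    by blast
  have s0: "s w \<noteq> 0" if "w \<in> ball w0 R" for w
    using s2[OF that] \<phi>(2)[of w] R(2) that by auto
  obtain \<zeta> where "\<And>x. x \<in> ball w0 R \<Longrightarrow> (\<zeta> has_field_derivative s x) (at x within ball w0 R)"
    using holomorphic_convex_primitive'[OF convex_ball open_ball s] by blast
  then have \<zeta>: "(\<zeta> has_field_derivative s x) (at x)" if "x \<in> ball w0 R" for x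
    using that by (metis at_within_open open_ball)
  have "\<zeta> holomorphic_on ball w0 R" using \<zeta> holomorphic_on_open[OF open_ball] by blast
  moreover have "deriv \<zeta> w0 \<noteq> 0" using DERIV_imp_deriv[OF \<zeta>[of w0]] s0[of w0] R(1) by simp
  ultimately obtain r where r: "r > 0" "ball w0 r \<subseteq> ball w0 R" "inj_on \<zeta> (ball w0 r)"
    using R(1) by (elim has_complex_derivative_locally_injective[where \<xi> = w0]) auto
  show thesis
    by (rule that[of r s \<zeta>]) (use r R s s2 s0 \<zeta> holomorphic_on_subset in \<open>auto simp: subset_iff\<close>)
qed

lemma holomorphic_map_frame_transform:
  assumes M: "riemann_surface M A" and U: "(U, \<phi>) \<in> A"
    and W: "open W" "W \<subseteq> \<phi> ` U" and c: "\<forall>k. (\<lambda>w. c w $ k) holomorphic_on W"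
    and b: "\<forall>w\<in>W. bilin (c w) (c w) = -4"
  defines "V \<equiv> U \<inter> \<phi> -` W"
  defines "G \<equiv> \<lambda>w. frame_transform (Re_vec (c w)) (Re_vec (\<i> *s c w))"
  shows "holomorphic_map V (restrict_atlas A V) S2 S2_atlas (G \<circ> \<phi>)"
proof -
  have Uc: "chart_on M U \<phi>" and charts: "\<And>V' \<psi>. (V', \<psi>) \<in> A \<Longrightarrow> chart_on M V' \<psi>"
    and comp: "\<And>c d. c \<in> A \<Longrightarrow> d \<in> A \<Longrightarrow> compatible c d"
    using M U unfolding riemann_surface_def by blast+
  have hol: "continuous_on W G" "(stereo \<circ> G) holomorphic_on {w\<in>W. G w $ 3 \<noteq> 1}"
    "(stereo_inf \<circ> G) holomorphic_on {w\<in>W. G w $ 3 \<noteq> -1}"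
    using frame_transform_holomorphic[OF W(1) c b] unfolding G_def by blast+
  have "continuous_on U \<phi>"
    using chart_on_homeomorphism[OF Uc] unfolding homeomorphism_def by blast
  then have 1: "continuous_on V (G \<circ> \<phi>)"
    by (intro continuous_on_compose continuous_on_subset[OF hol(1)])
       (auto simp: V_def intro: continuous_on_subset)
  have "adapted_frame (Re_vec (c w)) (Re_vec (\<i> *s c w))" if "w \<in> W" for w
    unfolding adapted_frame_iff_bilin cvec_Re_vec using b that by blast
  then have 2: "(G \<circ> \<phi>) ` V \<subseteq> S2"
    unfolding G_def V_def using frame_transform_in_S2 by fastforce
  have 3: "(P \<circ> (G \<circ> \<phi>) \<circ> inv_into (V' \<inter> V) \<psi>) holomorphic_on \<psi> ` ((V' \<inter> V) \<inter> (G \<circ> \<phi>) -` {v\<in>S2. v$3 \<noteq> e})"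
    if V': "(V', \<psi>) \<in> A" and P: "(P \<circ> G) holomorphic_on {w\<in>W. G w $ 3 \<noteq> e}"
    for V' \<psi> e and P :: "real^3 \<Rightarrow> complex"
  proof -
    have inj: "inj_on \<psi> V'" using chart_on_inj[OF charts[OF V']] .
    then have inv: "inv_into V' \<psi> (\<psi> y) = y" if "y \<in> V'" for y using that by simp
    have inv2: "inv_into (V' \<inter> V) \<psi> (\<psi> y) = y" if "y \<in> V'" "y \<in> V" for y
      using inv_into_f_f[OF inj_on_subset[OF inj]] that by auto
    have "compatible (U, \<phi>) (V', \<psi>)" using comp U V' by blast
    then have "(\<phi> \<circ> inv_into V' \<psi>) holomorphic_on \<psi> ` (U \<inter> V')" unfolding compatible_def by auto
    then have tr: "(\<phi> \<circ> inv_into V' \<psi>) holomorphic_on \<psi> ` ((V' \<inter> V) \<inter> (G \<circ> \<phi>) -` {v\<in>S2. v$3 \<noteq> e})"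
      by (rule holomorphic_on_subset) (auto simp: V_def)
    have "((P \<circ> G) \<circ> (\<phi> \<circ> inv_into V' \<psi>)) holomorphic_on \<psi> ` ((V' \<inter> V) \<inter> (G \<circ> \<phi>) -` {v\<in>S2. v$3 \<noteq> e})"
      by (rule holomorphic_on_compose_gen[OF tr P]) (auto simp: V_def inv)
    then show ?thesis
      by (rule holomorphic_transform) (auto simp: inv inv2)
  qed
  show ?thesis
    unfolding holomorphic_map_S2_iff restrict_atlas_def using 1 2 3[OF _ hol(2)] 3[OF _ hol(3)] by auto
qed

text \<open>
  All functions are first described on a disc \<open>W\<close> in a chart \<open>\<phi>\<close> of the atlas: \<open>F = Re \<Psi>\<close> is the
  surface, \<open>s\<close> is a square root of \<open>-\<langle>F\<^sub>z, F\<^sub>z\<rangle>\<close> with primitive \<open>\<zeta>\<close>, and \<open>c = \<Psi>'/s\<close> is the vector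
  \<open>X - iY\<close> of the adapted coordinate \<open>z = \<zeta> \<circ> \<phi>\<close>.  The primitive in the formula is \<open>\<Psi>/4\<close>, expressed
  in this coordinate.
\<close>

lemma local_representation:
  assumes M: "riemann_surface M A" and f: "nonconformal_harmonic_surface M A f" and p: "p \<in> M"
  shows "\<exists>U z g h.
           openin (top_of_set M) U \<and> p \<in> U \<and> simply_connected U \<and>
           complex_coordinate M A U z \<and>
           holomorphic_map U (restrict_atlas A U) S2 S2_atlas g \<and>
           holomorphic_map U (restrict_atlas A U) S2 S2_atlas h \<and>
           (\<forall>q\<in>U. g q - h q \<noteq> 0 \<and> g q + h q \<noteq> 0) \<and>
           given_by_formula U z g h f"
proof -
  obtain U \<phi> where U: "(U, \<phi>) \<in> A" "p \<in> U" using M p unfolding riemann_surface_def by blast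
  then have Uc: "chart_on M U \<phi>" using M unfolding riemann_surface_def by blast
  have inv: "inv_into U \<phi> (\<phi> y) = y" if "y \<in> U" for y using chart_on_inj[OF Uc] that by simp
  define D where "D = \<phi> ` U"
  define F where "F = in_coord f U \<phi>"
  define fz where "fz = d_z (cvec \<circ> F)"
  have D: "open D" "\<phi> p \<in> D" using Uc U(2) unfolding chart_on_def D_def by auto
  have F: "smooth_on D F" "\<forall>w\<in>D. d_zbar (d_z (cvec \<circ> F)) w = 0"
    "\<And>w. w \<in> D \<Longrightarrow> inj (frechet_derivative F (at w))" "\<And>w. w \<in> D \<Longrightarrow> bilin (fz w) (fz w) \<noteq> 0"
    using f U(1) unfolding nonconformal_harmonic_surface_def harmonic_immersion_def Let_def
      D_def F_def fz_def by blast+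
  have fzh: "(\<lambda>w. fz w $ k) holomorphic_on D" for k
    unfolding fz_def by (rule harmonic_d_z_holomorphic[OF D(1) F(1,2)])
  obtain r s \<zeta> where r: "r > 0" and WD: "ball (\<phi> p) r \<subseteq> D" and s: "s holomorphic_on ball (\<phi> p) r"
    and s2: "\<And>w. w \<in> ball (\<phi> p) r \<Longrightarrow> s w \<noteq> 0 \<and> (s w)\<^sup>2 = - bilin (fz w) (fz w)"
    and \<zeta>: "\<And>w. w \<in> ball (\<phi> p) r \<Longrightarrow> (\<zeta> has_field_derivative s w) (at w)" "inj_on \<zeta> (ball (\<phi> p) r)"
    using adapted_reparametrisation[OF D fzh F(4)] by blast
  define W where "W = ball (\<phi> p) r"
  note WD = WD[folded W_def] and s = s[folded W_def] and s2 = s2[folded W_def] and \<zeta> = \<zeta>[folded W_def]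
  have W: "open W" "convex W" "W \<subseteq> \<phi> ` U" "\<phi> p \<in> W" using WD r unfolding W_def D_def by auto
  have \<zeta>h: "\<zeta> holomorphic_on W" using \<zeta>(1) holomorphic_on_open[OF W(1)] by blast
  have FW: "smooth_on W F" "\<forall>w\<in>W. d_zbar (d_z (cvec \<circ> F)) w = 0"
  proof -
    have "diff_times n D G \<Longrightarrow> diff_times n W G" for n and G :: "complex \<Rightarrow> real^3"
      using WD by (induction n arbitrary: G) (auto intro: continuous_on_subset)
    then show "smooth_on W F" using F(1) unfolding smooth_on_def by blast
    show "\<forall>w\<in>W. d_zbar (d_z (cvec \<circ> F)) w = 0" using F(2) WD by blast
  qed
  obtain \<Psi> :: "complex \<Rightarrow> complex^3" where
    \<Psi>: "\<forall>w\<in>W. \<forall>k. ((\<lambda>w. \<Psi> w $ k) has_field_derivative (2 *s fz w) $ k) (at w)"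
    and F\<Psi>: "\<forall>w\<in>W. F w = Re_vec (\<Psi> w)"
    using harmonic_eq_Re_vec_primitive[OF W(1,2) FW] unfolding fz_def by metis
  define c where "c = (\<lambda>w. (2 / s w) *s fz w)"
  have ch: "\<forall>k. (\<lambda>w. c w $ k) holomorphic_on W"
    unfolding c_def using fzh s s2 WD by (auto intro!: holomorphic_intros holomorphic_on_subset[OF fzh])
  have cc: "bilin (c w) (c w) = -4" if "w \<in> W" for w
  proof -
    have "bilin (fz w) (fz w) = - (s w)\<^sup>2" using s2[OF that] by simp
    then show ?thesis unfolding c_def bilin_scale using s2[OF that] by (simp add: power2_eq_square)
  qed
  have mc: "bilin (- c w) (- c w) = -4" if "w \<in> W" for w
    using cc[OF that] by (simp add: bilin_def)
  define X Y where "X = (\<lambda>w. Re_vec (c w))" and "Y = (\<lambda>w. Re_vec (\<i> *s c w))"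
  have XY: "cvec (X w) - \<i> *s cvec (Y w) = c w" for w unfolding X_def Y_def by (rule cvec_Re_vec)
  have fr: "adapted_frame (X w) (Y w)" if "w \<in> W" for w
    unfolding adapted_frame_iff_bilin XY using cc[OF that] .
  \<comment> \<open>\<open>X\<close> is the value of the injective derivative of \<open>F\<close> at the nonzero vector \<open>1 / s w\<close>.\<close>
  have X0: "X w \<noteq> 0" if w: "w \<in> W" for w
  proof
    assume "X w = 0"
    have "frechet_derivative F (at w) = (\<lambda>v. Re_vec (v *s (2 *s fz w)))"
      by (rule frechet_derivative_at[OF Re_vec_has_derivative[OF _ W(1) w F\<Psi>], symmetric])
         (use \<Psi> w in blast)
    then have inj: "inj (\<lambda>v. Re_vec (v *s (2 *s fz w)))" using F(3)[of w] w WD by auto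
    have "Re_vec ((1 / s w) *s (2 *s fz w)) = X w"
      unfolding X_def c_def by (simp add: Re_vec_def vec_eq_iff)
    also have "\<dots> = Re_vec (0 *s (2 *s fz w))"
      using \<open>X w = 0\<close> by (simp add: Re_vec_def vec_eq_iff)
    finally have "1 / s w = 0" by (rule injD[OF inj])
    then show False using s2[OF w] by simp
  qed
  define V where "V = U \<inter> \<phi> -` W"
  define z where "z = \<zeta> \<circ> \<phi>"
  define g where "g = (\<lambda>w. frame_transform (X w) (Y w)) \<circ> \<phi>"
  define h where "h = (\<lambda>w. frame_transform (- X w) (- Y w)) \<circ> \<phi>"
  note V = reparametrised_chart[OF M U(1) W(1,3) \<zeta>h \<zeta>(2), folded V_def z_def]
  have "simply_connected W" using W(2) convex_imp_simply_connected by blast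
  then have sc: "simply_connected V" using V(3) homeomorphic_simply_connected homeomorphic_sym by blast
  have g: "holomorphic_map V (restrict_atlas A V) S2 S2_atlas g"
    using holomorphic_map_frame_transform[OF M U(1) W(1,3) ch] cc unfolding g_def V_def X_def Y_def by blast
  have "X w = - Re_vec (- c w)" "Y w = - Re_vec (\<i> *s - c w)" for w
    unfolding X_def Y_def Re_vec_def by (simp_all add: vec_eq_iff)
  moreover have "\<forall>k. (\<lambda>w. (- c w) $ k) holomorphic_on W" using ch by (auto intro!: holomorphic_intros)
  ultimately have h: "holomorphic_map V (restrict_atlas A V) S2 S2_atlas h"
    using holomorphic_map_frame_transform[OF M U(1) W(1,3), of "\<lambda>w. - c w"] mc unfolding h_def V_def by simp
  have gh: "g q - h q \<noteq> 0" "g q + h q \<noteq> 0" "integrand (g q) (h q) = (1/4) *s c (\<phi> q)" if "q \<in> V" for q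
  proof -
    have w: "\<phi> q \<in> W" using that unfolding V_def by simp
    show "g q - h q \<noteq> 0" "g q + h q \<noteq> 0" "integrand (g q) (h q) = (1/4) *s c (\<phi> q)"
      unfolding g_def h_def o_def
      using frame_transform_diff_nonzero[OF fr[OF w]] frame_transform_sum_nonzero[OF fr[OF w] X0[OF w]]
        integrand_frame_transform[OF fr[OF w]] unfolding XY by blast+
  qed
  obtain \<zeta>' where \<zeta>': "\<zeta>' holomorphic_on \<zeta> ` W"
    "\<And>w. w \<in> W \<Longrightarrow> deriv \<zeta> w * deriv \<zeta>' (\<zeta> w) = 1" "\<And>w. w \<in> W \<Longrightarrow> \<zeta>' (\<zeta> w) = w"
    using holomorphic_has_inverse[OF \<zeta>h W(1) \<zeta>(2)] by metis
  have o\<zeta>: "open (\<zeta> ` W)" by (rule open_mapping_thm3[OF \<zeta>h W(1) \<zeta>(2)])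
  have \<zeta>'d: "(\<zeta>' has_field_derivative 1 / s w) (at (\<zeta> w))" if w: "w \<in> W" for w
  proof -
    have "deriv \<zeta> w = s w" using \<zeta>(1)[OF w] by (rule DERIV_imp_deriv)
    then have "deriv \<zeta>' (\<zeta> w) = 1 / s w" using \<zeta>'(2)[OF w] s2[OF w] by (simp add: field_simps)
    then show ?thesis using holomorphic_derivI[OF \<zeta>'(1) o\<zeta>, of "\<zeta> w"] w by simp
  qed
  have zinv: "inv_into V z (z q) = q" if "q \<in> V" for q
    using V(2) that chart_on_inj unfolding complex_coordinate_def by (metis inv_into_f_f)
  have "given_by_formula V z g h f"
    unfolding given_by_formula_def
  proof (intro exI[of _ "\<lambda>v. (1/4) *s \<Psi> (\<zeta>' v)"] conjI ballI allI)
    fix v k assume "v \<in> z ` V"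
    then obtain q where q: "q \<in> V" "v = z q" by blast
    then have w: "\<phi> q \<in> W" "v = \<zeta> (\<phi> q)" unfolding V_def z_def by auto
    have "((\<lambda>w. \<Psi> w $ k) has_field_derivative (2 *s fz (\<phi> q)) $ k) (at (\<zeta>' v))"
      using \<Psi> w(1) \<zeta>'(3)[OF w(1)] w(2) by simp
    from DERIV_cmult[OF DERIV_chain2[OF this \<zeta>'d[OF w(1), folded w(2)]], of "1/4"]
    show "((\<lambda>v. ((1/4) *s \<Psi> (\<zeta>' v)) $ k) has_field_derivative
        integrand (in_coord g V z v) (in_coord h V z v) $ k) (at v)"
      unfolding in_coord_def o_def q(2) zinv[OF q(1)] gh(3)[OF q(1)] c_def
      by (simp add: mult.commute)
  next
    fix q assume q: "q \<in> V"
    then have w: "\<phi> q \<in> W" "q \<in> U" unfolding V_def by auto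
    have "f q = F (\<phi> q)" unfolding F_def in_coord_def using inv[OF w(2)] by simp
    also have "\<dots> = Re_vec (\<Psi> (\<zeta>' (z q)))"
      using F\<Psi> w(1) \<zeta>'(3)[OF w(1)] unfolding z_def by simp
    finally show "f q = 4 *\<^sub>R Re_vec ((1/4) *s \<Psi> (\<zeta>' (z q)))"
      by (simp add: Re_vec_def vec_eq_iff)
  qed
  moreover have "p \<in> V" using U(2) W(4) unfolding V_def by simp
  ultimately show ?thesis using V(1,2) sc g h gh(1,2) by blast
qed

section \<open>The representation theorem\<close>

theorem theorem1p1:
  fixes M :: "'a::t2_space set" and A :: "'a atlas"
  assumes "riemann_surface M A"
  shows "(\<forall>z g h.
            simply_connected M \<and> complex_coordinate M A M z \<and>
            holomorphic_map M A S2 S2_atlas g \<and> holomorphic_map M A S2 S2_atlas h \<and>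
            (\<forall>p\<in>M. g p - h p \<noteq> 0 \<and> g p + h p \<noteq> 0) \<longrightarrow>
            (\<exists>f. given_by_formula M z g h f) \<and>
            (\<forall>f. given_by_formula M z g h f \<longrightarrow>
               nonconformal_harmonic_surface M A f \<and> adapted M z f \<and>
               (\<forall>p\<in>M. transform 1 M z f p = g p \<and> transform (-1) M z f p = h p)))
       \<and> (\<forall>f. nonconformal_harmonic_surface M A f \<longrightarrow>
            (\<forall>p\<in>M. \<exists>U z g h.
               openin (top_of_set M) U \<and> p \<in> U \<and> simply_connected U \<and>
               complex_coordinate M A U z \<and>
               holomorphic_map U (restrict_atlas A U) S2 S2_atlas g \<and>
               holomorphic_map U (restrict_atlas A U) S2 S2_atlas h \<and>
               (\<forall>q\<in>U. g q - h q \<noteq> 0 \<and> g q + h q \<noteq> 0) \<and>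
               given_by_formula U z g h f))"
proof (intro conjI allI impI ballI; (elim conjE)?)
  fix z g h
  assume z: "simply_connected M" "complex_coordinate M A M z"
    and g: "holomorphic_map M A S2 S2_atlas g" and h: "holomorphic_map M A S2 S2_atlas h"
    and gh: "\<forall>p\<in>M. g p - h p \<noteq> 0 \<and> g p + h p \<noteq> 0"
  show "\<exists>f. given_by_formula M z g h f"
    by (rule exists_representation[OF assms z g h gh])
  have "\<forall>p\<in>M. g p \<in> S2" "\<forall>p\<in>M. h p \<in> S2" using g h unfolding holomorphic_map_def by blast+
  note surface = representation_surface[OF assms z(2) this gh]
  fix f assume f: "given_by_formula M z g h f"
  show "nonconformal_harmonic_surface M A f" "adapted M z f" using surface(1,2)[OF f] .
  show "transform 1 M z f p = g p" "transform (-1) M z f p = h p" if "p \<in> M" for p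
    using surface(3,4)[OF f that] .
next
  fix f p assume "nonconformal_harmonic_surface M A f" "p \<in> M"
  then show "\<exists>U z g h.
           openin (top_of_set M) U \<and> p \<in> U \<and> simply_connected U \<and>
           complex_coordinate M A U z \<and>
           holomorphic_map U (restrict_atlas A U) S2 S2_atlas g \<and>
           holomorphic_map U (restrict_atlas A U) S2 S2_atlas h \<and>
           (\<forall>q\<in>U. g q - h q \<noteq> 0 \<and> g q + h q \<noteq> 0) \<and>
           given_by_formula U z g h f"
    by (rule local_representation[OF assms])
qed

end
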